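(* Let $k\ge 1$ be an integer. (1) If $C_k^>\cap(\mathbb{R}_+\times\mathbb{R}_+)\neq\emptyset$, then there exist $\alpha_k^>\ge\lambda_1^m$, $\beta_k^>\ge\lambda_1^n$ and a strictly decreasing $C^1$-diffeomorphism $f_k^>$ from $]\alpha_k^>,+\infty[$ onto $]\beta_k^>,+\infty[$ such that $$C_k^>\cap(\mathbb{R}_+\times\mathbb{R}_+)=\{(a,f_k^>(a)) : a\in\,]\alpha_k^>,+\infty[\}.$$ The same holds for $C_k^<$ in place of $C_k^>$ (with corresponding constants and diffeomorphism). (2) Similar results hold in the other three quadrants. Namely, let $C$ be either of $C_k^>$, $C_k^<$. (a) If $C\cap(\mathbb{R}_-\times\mathbb{R}_+)\ne\emptyset$, there exist $\gamma\le\lambda_{-1}^m$, $\eta\ge\lambda_1^n$ and a strictly increasing $C^1$-diffeomorphism $g$ from $]-\infty,\gamma[$ onto $]\eta,+\infty[$ such that $C\cap(\mathbb{R}_-\times\mathbb{R}_+)=\{(a,g(a)):a\in\,]-\infty,\gamma[\}$. (b) If $C\cap(\mathbb{R}_+\times\mathbb{R}_-)\ne\emptyset$, there exist $\gamma\ge\lambda_{1}^m$, $\eta\le\lambda_{-1}^n$ and a strictly increasing $C^1$-diffeomorphism $g$ from $]\gamma,+\infty[$ onto $]-\infty,\eta[$ such that $C\cap(\mathbb{R}_+\times\mathbb{R}_-)=\{(a,g(a)):a\in\,]\gamma,+\infty[\}$. (c) If $C\cap(\mathbb{R}_-\times\mathbb{R}_-)\ne\emptyset$, there exist $\gamma\le\lambda_{-1}^m$,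 $\eta\le\lambda_{-1}^n$ and a strictly decreasing $C^1$-diffeomorphism $g$ from $]-\infty,\gamma[$ onto $]-\infty,\eta[$ such that $C\cap(\mathbb{R}_-\times\mathbb{R}_-)=\{(a,g(a)):a\in\,]-\infty,\gamma[\}$.
   Context: Let $T_1<T_2$ be real numbers, $p,q,m,n\in C[T_1,T_2]$ with $p(t)>0$ and $q(t)\ge 0$ on $[T_1,T_2]$, $m\not\equiv 0$, $n\not\equiv0$, and $Lu:=-[p(t)u']'+q(t)u$. Write $u^\pm:=\max\{\pm u,0\}$, $\mathbb{R}_+=[0,+\infty[$, $\mathbb{R}_-=\,]-\infty,0]$. Consider the problem $$Lu=a\,m(t)u^+-b\,n(t)u^-\ \text{in } ]T_1,T_2[,\qquad u'(T_1)=0=u'(T_2).\qquad(P)$$ For $k\ge0$, $C_k^>$ (resp. $C_k^<$) is the set of $(a,b)\in\mathbb{R}^2$ such that $(P)$ has a nontrivial solution with exactly $k$ zeros in $]T_1,T_2[$ and with $u(T_2)>0$ (resp. $u(T_2)<0$). For a weight $w\in C[T_1,T_2]$, $w\not\equiv0$, a principal eigenvalue of $Lu=\lambda w(t)u$ in $]T_1,T_2[$, $u'(T_1)=0=u'(T_2)$, is a real $\lambda$ having an eigenfunction without zeros. When $w^+\not\equiv0$, $\lambda_1^w$ denotes the principal positive eigenvalue, i.e. the largest principal eigenvalue (one has $\lambda_1^w\ge0$, the value $0$ being possible when $q\equiv0$); when $w^-\not\equiv0$, $\lambda_{-1}^w$ denotes the principal negative eigenvalue, i.e. the smallest principal eigenvalue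 (one has $\lambda_{-1}^w\le0$, the value $0$ being possible when $q\equiv0$). *)

theory Defs
  imports "HOL-Analysis.Analysis"
begin

(* u is a classical solution of  -(p u')' + q u = h  in ]T1,T2[  with  u'(T1) = 0 = u'(T2):
   u is C^1 on [T1,T2] (derivative u', one-sided at the endpoints) and p u' has derivative v
   in ]T1,T2[.  As p is merely continuous, u itself need not be twice differentiable. *)
definition neumann_solution ::
  "real \<Rightarrow> real \<Rightarrow> (real \<Rightarrow> real) \<Rightarrow> (real \<Rightarrow> real) \<Rightarrow> (real \<Rightarrow> real) \<Rightarrow> (real \<Rightarrow> real) \<Rightarrow> bool"
  where "neumann_solution T1 T2 p q h u \<longleftrightarrow>
    (\<exists>u' v. continuous_on {T1..T2} u' \<and>
      (\<forall>t\<in>{T1..T2}. (u has_real_derivative u' t) (at t within {T1..T2})) \<and>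
      (\<forall>t\<in>{T1<..<T2}. ((\<lambda>s. p s * u' s) has_real_derivative v t) (at t) \<and>
                      - v t + q t * u t = h t) \<and>
      u' T1 = 0 \<and> u' T2 = 0)"

definition solves_P ::
  "real \<Rightarrow> real \<Rightarrow> (real \<Rightarrow> real) \<Rightarrow> (real \<Rightarrow> real) \<Rightarrow> (real \<Rightarrow> real) \<Rightarrow> (real \<Rightarrow> real) \<Rightarrow>
   real \<Rightarrow> real \<Rightarrow> (real \<Rightarrow> real) \<Rightarrow> bool"
  where "solves_P T1 T2 p q m n a b u \<longleftrightarrow>
    neumann_solution T1 T2 p q (\<lambda>t. a * m t * max (u t) 0 - b * n t * max (- u t) 0) u"

definition nontrivial_with_zeros :: "real \<Rightarrow> real \<Rightarrow> nat \<Rightarrow> (real \<Rightarrow> real) \<Rightarrow> bool"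
  where "nontrivial_with_zeros T1 T2 k u \<longleftrightarrow>
    (\<exists>t\<in>{T1..T2}. u t \<noteq> 0) \<and>
    finite {t \<in> {T1<..<T2}. u t = 0} \<and> card {t \<in> {T1<..<T2}. u t = 0} = k"

definition C_gt ::
  "real \<Rightarrow> real \<Rightarrow> (real \<Rightarrow> real) \<Rightarrow> (real \<Rightarrow> real) \<Rightarrow> (real \<Rightarrow> real) \<Rightarrow> (real \<Rightarrow> real) \<Rightarrow>
   nat \<Rightarrow> (real \<times> real) set"
  where "C_gt T1 T2 p q m n k =
    {(a, b). \<exists>u. solves_P T1 T2 p q m n a b u \<and> nontrivial_with_zeros T1 T2 k u \<and> u T2 > 0}"

definition C_lt ::
  "real \<Rightarrow> real \<Rightarrow> (real \<Rightarrow> real) \<Rightarrow> (real \<Rightarrow> real) \<Rightarrow> (real \<Rightarrow> real) \<Rightarrow> (real \<Rightarrow> real) \<Rightarrow>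
   nat \<Rightarrow> (real \<times> real) set"
  where "C_lt T1 T2 p q m n k =
    {(a, b). \<exists>u. solves_P T1 T2 p q m n a b u \<and> nontrivial_with_zeros T1 T2 k u \<and> u T2 < 0}"

definition principal_eigenvalue ::
  "real \<Rightarrow> real \<Rightarrow> (real \<Rightarrow> real) \<Rightarrow> (real \<Rightarrow> real) \<Rightarrow> (real \<Rightarrow> real) \<Rightarrow> real \<Rightarrow> bool"
  where "principal_eigenvalue T1 T2 p q w \<mu> \<longleftrightarrow>
    (\<exists>u. neumann_solution T1 T2 p q (\<lambda>t. \<mu> * w t * u t) u \<and> (\<forall>t\<in>{T1<..<T2}. u t \<noteq> 0))"

(* Meaningful only if w is positive somewhere (for lambda_pos) or negative somewhere
   (for lambda_neg) on [T1,T2]: then the extremal principal eigenvalue exists. *)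
definition lambda_pos ::
  "real \<Rightarrow> real \<Rightarrow> (real \<Rightarrow> real) \<Rightarrow> (real \<Rightarrow> real) \<Rightarrow> (real \<Rightarrow> real) \<Rightarrow> real"
  where "lambda_pos T1 T2 p q w = (GREATEST \<mu>. principal_eigenvalue T1 T2 p q w \<mu>)"

definition lambda_neg ::
  "real \<Rightarrow> real \<Rightarrow> (real \<Rightarrow> real) \<Rightarrow> (real \<Rightarrow> real) \<Rightarrow> (real \<Rightarrow> real) \<Rightarrow> real"
  where "lambda_neg T1 T2 p q w = (LEAST \<mu>. principal_eigenvalue T1 T2 p q w \<mu>)"

(* Intended for open S and T. *)
definition C1_diffeomorphism :: "(real \<Rightarrow> real) \<Rightarrow> real set \<Rightarrow> real set \<Rightarrow> bool"
  where "C1_diffeomorphism f S T \<longleftrightarrow>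
    bij_betw f S T \<and> f C1_differentiable_on S \<and> the_inv_into S f C1_differentiable_on T"

end

(*
  Write a solution in polar form u = R sin \<theta>, p u' = R cos \<theta> (Pruefer).  The angle solves a scalar ODE
  in which a and b enter linearly through the squares of the positive and the negative part of sin \<theta>,
  and it crosses multiples of pi only upwards.  Hence C_k is the level set \<Theta>(a, b) = pi/2 of the final
  angle, started at pi/2 - k pi for C_k^> (C_k^< follows by u \<mapsto> -u).  The equation satisfied by the
  difference of two angles is linear and gives
    \<Theta>(x) - \<Theta>(y) = (a_x - a_y) A(x, y) + (b_x - b_y) B(x, y)
  with A, B continuous; A(x, x) and B(x, x) are, up to a positive factor, the integrals of m (u^+)^2 and
  n (u^-)^2.  Testing the equation with u^+ and u^- gives a A(x, x) > 0 and b B(x, x) > 0 on the level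
  set, so inside a quadrant the level is crossed at most once along every horizontal and every vertical line,
  always in the same direction; with \<Theta>(0, 0) < pi/2 this makes it a decreasing C^1 curve over a half-line.
  For (a, b) on the curve, comparison on a nodal interval shows that the angle of the linear problem
  with weight a m ends above pi/2.  So the principal eigenvalues of m form a closed set bounded by the
  left end of the half-line, nonempty by the intermediate value theorem.  The other quadrants follow
  by changing the signs of m and n.
*)
theory Submission
  imports Defs
begin


text \<open>Since \<open>m\<close> and \<open>n\<close> may change sign, the final angle need not be
  monotone in a or in b; only the direction in which it passes the level pi/2 is known. Hence the
  role of the up-crossing principle: if the derivative is positive wherever the function equals c,
  the function cannot come back to c. It serves twice, for the angle in t at multiples of pi and for
  the final angle in a or b at pi/2.

  The sine enters through squared positive parts because these are C^1 with bounded derivative. The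
  angle equation is then globally Lipschitz, and differences of its right-hand side factor through a
  jointly continuous mean slope. A and B inherit the joint continuity, so Caratheodory's form of the
  derivative gives the C^1 curve without differentiating a flow.

  As \<open>p\<close> is only continuous, the equation is treated as a planar system for u and p u'.
  The radius R is no second unknown: it is an explicit exponential of the angle, and R^2 is up to a
  constant the factor that propagates differences of angles. This is what turns A(x, x) and B(x, x)
  into integrals of m (u^+)^2 and n (u^-)^2.\<close>

section \<open>Up-crossing of a level\<close>

text \<open>Let \<open>z\<close> be the last time at which g is at least c. If g ended below c, then
  g z = c by the intermediate value theorem, and the positive derivative would lift g above c right
  after \<open>z\<close>.\<close>

lemma upcrossing_weak:
  fixes g :: "real \<Rightarrow> real"
  assumes cont: "continuous_on {s..t} g" and "s \<le> t" "g s \<ge> c"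
    and der: "\<And>x. x \<in> {s..t} \<Longrightarrow> g x = c \<Longrightarrow> \<exists>d>0. (g has_real_derivative d) (at x within {s..t})"
  shows "g t \<ge> c"
proof (rule ccontr)
  assume "\<not> g t \<ge> c"
  then have gt: "g t < c" by simp
  define Z where "Z = {x\<in>{s..t}. g x \<ge> c}"
  have "closed Z"
    unfolding Z_def using continuous_on_closed_Collect_le[OF continuous_on_const cont]
    by auto
  have ne: "Z \<noteq> {}" and bdd: "bdd_above Z"
    using assms by (auto simp: Z_def)
  define z where "z = Sup Z"
  have "z \<in> Z"
    unfolding z_def using closed_contains_Sup[OF ne bdd \<open>closed Z\<close>] .
  then have z: "s \<le> z" "z \<le> t" "g z \<ge> c" by (auto simp: Z_def)
  have upper: "x \<le> z" if "x \<in> Z" for x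
    unfolding z_def by (rule cSup_upper[OF that bdd])
  obtain x where x: "z \<le> x" "x \<le> t" "g x = c"
    using IVT2'[of g t c z] z gt continuous_on_subset[OF cont, of "{z..t}"] by auto
  have "x \<in> Z" using x z by (auto simp: Z_def)
  then have "g z = c" using upper[of x] x by auto
  then obtain d where d: "d > 0" "(g has_real_derivative d) (at z within {s..t})"
    using der[of z] z by auto
  obtain e where e: "e > 0" "\<And>h. h > 0 \<Longrightarrow> z + h \<in> {s..t} \<Longrightarrow> h < e \<Longrightarrow> g z < g (z + h)"
    using has_real_derivative_pos_inc_right[OF d(2,1)] by blast
  have "z < t" using gt z by (cases "z = t") auto
  define h where "h = min (e/2) (t - z)"
  have h: "h > 0" "h < e" "z + h \<in> {s..t}"
    using e(1) \<open>z < t\<close> z by (auto simp: h_def min_def)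
  have "z + h \<in> Z" using e(2)[OF h(1,3,2)] h(3) \<open>g z = c\<close> by (auto simp: Z_def)
  then show False using upper[of "z+h"] h(1) by auto
qed

text \<open>Equality at \<open>t\<close> is impossible: the positive derivative would put g below c
  just before \<open>t\<close>, against the weak form on the shorter interval
  \<open>{s..t - h}\<close>.\<close>

lemma upcrossing:
  fixes g :: "real \<Rightarrow> real"
  assumes cont: "continuous_on {s..t} g" and "s < t" "g s \<ge> c"
    and der: "\<And>x. x \<in> {s..t} \<Longrightarrow> g x = c \<Longrightarrow> \<exists>d>0. (g has_real_derivative d) (at x within {s..t})"
  shows "g t > c"
proof (rule ccontr)
  assume "\<not> g t > c"
  moreover have "g t \<ge> c" by (rule upcrossing_weak[OF cont _ \<open>g s \<ge> c\<close> der]) (use \<open>s < t\<close> in auto)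
  ultimately have "g t = c" by simp
  then obtain d where d: "d > 0" "(g has_real_derivative d) (at t within {s..t})"
    using der[of t] \<open>s < t\<close> by auto
  obtain e where e: "e > 0" "\<And>h. h > 0 \<Longrightarrow> t - h \<in> {s..t} \<Longrightarrow> h < e \<Longrightarrow> g (t - h) < g t"
    using has_real_derivative_pos_inc_left[OF d(2,1)] by blast
  define h where "h = min (e/2) (t - s)"
  have h: "h > 0" "h < e" "t - h \<in> {s..t}"
    using e(1) \<open>s < t\<close> by (auto simp: h_def min_def)
  have "g (t - h) < c" using e(2)[OF h(1,3,2)] \<open>g t = c\<close> by simp
  moreover have "g (t - h) \<ge> c"
  proof (rule upcrossing_weak[where g = g and s = s])
    show "continuous_on {s..t - h} g" using cont h by (auto intro: continuous_on_subset)
    show "s \<le> t - h" using h by auto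
    show "g s \<ge> c" by fact
    fix x assume "x \<in> {s..t - h}" "g x = c"
    then show "\<exists>d>0. (g has_real_derivative d) (at x within {s..t - h})"
      using der[of x] h by (force intro: DERIV_subset)
  qed
  ultimately show False by simp
qed

section \<open>C^1 diffeomorphisms with an explicit inverse\<close>

text \<open>The inverse is carried along as a function, so that exchanging the axes or reflecting a
  coordinate acts on both maps at once. \<open>the_inv_into\<close> appears only in the final
  conversion.\<close>

definition C1_inverses :: "(real \<Rightarrow> real) \<Rightarrow> (real \<Rightarrow> real) \<Rightarrow> real set \<Rightarrow> real set \<Rightarrow> bool"
  where "C1_inverses f g S T \<longleftrightarrow>
    (\<forall>x\<in>S. f x \<in> T \<and> g (f x) = x) \<and> (\<forall>y\<in>T. g y \<in> S \<and> f (g y) = y) \<and>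
    f C1_differentiable_on S \<and> g C1_differentiable_on T"

text \<open>The derivative is taken at x and not within S, so f and g must agree on a neighbourhood
  of x; openness provides it.\<close>

lemma C1_differentiable_on_cong_open:
  fixes f g :: "real \<Rightarrow> real"
  assumes "f C1_differentiable_on S" "open S" "\<And>x. x \<in> S \<Longrightarrow> f x = g x"
  shows "g C1_differentiable_on S"
proof -
  obtain D where D: "\<And>x. x \<in> S \<Longrightarrow> (f has_vector_derivative D x) (at x)" "continuous_on S D"
    using assms(1) unfolding C1_differentiable_on_def by blast
  have "(g has_vector_derivative D x) (at x)" if "x \<in> S" for x
    by (rule has_vector_derivative_transform_within_open[OF D(1)[OF that] assms(2) that assms(3)])
  then show ?thesis using D(2) unfolding C1_differentiable_on_def by blast
qed

lemma C1_inverses_imp_diffeomorphism: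
  assumes "C1_inverses f g S T" "open T"
  shows "C1_diffeomorphism f S T"
proof -
  have bij: "bij_betw f S T"
    using assms(1) by (intro bij_betwI[where g = g]) (auto simp: C1_inverses_def)
  have "g y = the_inv_into S f y" if "y \<in> T" for y
    using assms(1) that the_inv_into_f_f[OF bij_betw_imp_inj_on[OF bij], of "g y"]
    by (auto simp: C1_inverses_def)
  then show ?thesis
    using assms bij C1_differentiable_on_cong_open[of g T "the_inv_into S f"]
    by (auto simp: C1_diffeomorphism_def C1_inverses_def)
qed

lemma C1_inverses_sym: "C1_inverses f g S T \<Longrightarrow> C1_inverses g f T S"
  by (auto simp: C1_inverses_def)

lemma C1_inverses_reflect_domain:
  assumes "C1_inverses f g S T"
  shows "C1_inverses (\<lambda>x. f (- x)) (\<lambda>y. - g y) (uminus ` S) T"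
proof -
  obtain D where D: "\<And>x. x \<in> S \<Longrightarrow> (f has_real_derivative D x) (at x)" "continuous_on S D"
    using assms unfolding C1_inverses_def C1_differentiable_on_def
    by (auto simp: has_real_derivative_iff_has_vector_derivative)
  have "((\<lambda>x. f (- x)) has_real_derivative - D (- x)) (at x)" if "x \<in> uminus ` S" for x
  proof -
    have "- x \<in> S" using that by auto
    then show ?thesis
      using DERIV_chain2[where f = f and g = uminus and x = x, OF D(1), of "-1" UNIV]
        DERIV_minus[OF DERIV_ident, of x UNIV] by simp
  qed
  moreover have "continuous_on (uminus ` S) (\<lambda>x. - D (- x))"
    by (intro continuous_intros continuous_on_compose2[OF D(2)]) auto
  ultimately have "(\<lambda>x. f (- x)) C1_differentiable_on (uminus ` S)"
    unfolding C1_differentiable_on_def has_real_derivative_iff_has_vector_derivative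
    by (intro exI[of _ "\<lambda>x. - D (- x)"]) simp
  moreover have "(\<lambda>y. - g y) C1_differentiable_on T"
  proof -
    obtain D where "\<forall>x\<in>T. (g has_vector_derivative D x) (at x)" "continuous_on T D"
      using assms unfolding C1_inverses_def C1_differentiable_on_def by blast
    then show ?thesis
      unfolding C1_differentiable_on_def
      by (intro exI[of _ "\<lambda>x. - D x"]) (auto intro!: derivative_eq_intros continuous_intros)
  qed
  ultimately show ?thesis using assms by (auto simp: C1_inverses_def)
qed

lemma C1_inverses_reflect_range:
  "C1_inverses f g S T \<Longrightarrow> C1_inverses (\<lambda>x. - f x) (\<lambda>y. g (- y)) S (uminus ` T)"
  using C1_inverses_reflect_domain C1_inverses_sym by blast

section \<open>A level curve in the first quadrant\<close>

text \<open>\<open>A\<close> and \<open>B\<close> are divided differences of \<open>Th\<close>; on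
  the diagonal they are its partial derivatives. The sign conditions also keep the level set off the
  axes, where one of them would read 0 > 0.\<close>

locale level_curve =
  fixes Th :: "real \<times> real \<Rightarrow> real" and A B :: "(real \<times> real) \<times> (real \<times> real) \<Rightarrow> real" and c :: real
  assumes cont_A: "continuous_on UNIV A" and cont_B: "continuous_on UNIV B"
    and diff: "Th x - Th y = (fst x - fst y) * A (x, y) + (snd x - snd y) * B (x, y)"
    and pos_A: "Th x = c \<Longrightarrow> fst x * A (x, x) > 0"
    and pos_B: "Th x = c \<Longrightarrow> snd x * B (x, x) > 0"
    and zero: "Th (0, 0) < c"
begin

lemma cont_Th: "continuous_on UNIV Th"
proof -
  have "Th x = Th (0,0) + ((fst x - 0) * A (x, (0,0)) + (snd x - 0) * B (x, (0,0)))" for x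
    using diff[of x "(0,0)"] by simp
  then have eq: "Th = (\<lambda>x. Th (0,0) + ((fst x - 0) * A (x, (0,0)) + (snd x - 0) * B (x, (0,0))))"
    by blast
  have "continuous_on UNIV (\<lambda>x. Th (0,0) + ((fst x - 0) * A (x, (0,0)) + (snd x - 0) * B (x, (0,0))))"
    by (intro continuous_intros continuous_on_compose2[OF cont_A] continuous_on_compose2[OF cont_B])
      auto
  then show ?thesis unfolding eq[symmetric] .
qed

lemma cont_fst: "continuous_on S (\<lambda>a. Th (a, b))"
  and cont_snd: "continuous_on S (\<lambda>b. Th (a, b))"
  by (auto intro!: continuous_on_compose2[OF cont_Th] continuous_intros)

lemma DERIV_fst: "((\<lambda>a. Th (a, b)) has_real_derivative A ((a, b), (a, b))) (at a)"
proof -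
  have "isCont (\<lambda>z. A ((z, b), (a, b))) a"
    using continuous_on_compose2[OF cont_A, of UNIV "\<lambda>z. ((z, b), (a, b))"]
    by (auto intro!: continuous_intros simp: continuous_on_eq_continuous_at)
  \<comment> \<open>Caratheodory's criterion: on a horizontal line the second term of
    \<open>diff\<close> vanishes, and \<open>A ((z, b), (a, b))\<close> is the required continuous
    slope function of z.\<close>
  then show ?thesis
    unfolding CARAT_DERIV using diff[of "(_, b)" "(a, b)"]
    by (intro exI[of _ "\<lambda>z. A ((z, b), (a, b))"]) auto
qed

text \<open>At a level point to the right of \<open>a\<close> the first coordinate is nonnegative,
  so \<open>pos_A\<close> makes the derivative \<open>A\<close> positive there and up-crossing
  applies.\<close>

lemma above_fst:
  assumes "0 \<le> a" "a < a'" "Th (a, b) \<ge> c"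
  shows "Th (a', b) > c"
proof (rule upcrossing[where g = "\<lambda>a. Th (a, b)" and s = a])
  fix x assume x: "x \<in> {a..a'}" "Th (x, b) = c"
  then have "A ((x, b), (x, b)) > 0"
    using pos_A[of "(x, b)"] assms by (auto simp: zero_less_mult_iff)
  then show "\<exists>d>0. ((\<lambda>a. Th (a, b)) has_real_derivative d) (at x within {a..a'})"
    using DERIV_fst has_field_derivative_at_within by blast
qed (use assms cont_fst in auto)

text \<open>\<open>Th\<close> is below c at the origin and, by \<open>pos_B\<close>, never equals c
  on this axis.\<close>

lemma axis_fst: assumes "a \<ge> 0" shows "Th (a, 0) < c"
proof (rule ccontr)
  assume "\<not> Th (a, 0) < c"
  then obtain x where "Th (x, 0) = c"
    using IVT'[of "\<lambda>a. Th (a, 0)" 0 c a] zero assms cont_fst by auto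
  then show False using pos_B[of "(x, 0)"] by auto
qed

text \<open>The hypotheses are symmetric in the two coordinates. Facts about vertical lines, and
  later the inverse of the curve, come from this instance.\<close>

lemma swapped: "level_curve (\<lambda>x. Th (prod.swap x)) (\<lambda>z. B (map_prod prod.swap prod.swap z))
    (\<lambda>z. A (map_prod prod.swap prod.swap z)) c"
proof
  show "continuous_on UNIV (\<lambda>z. A (map_prod prod.swap prod.swap z))"
    "continuous_on UNIV (\<lambda>z. B (map_prod prod.swap prod.swap z))"
    by (auto intro!: continuous_on_compose2[OF cont_A] continuous_on_compose2[OF cont_B]
        continuous_intros simp: map_prod_def prod.swap_def case_prod_unfold)
  show "Th (prod.swap x) - Th (prod.swap y) =
      (fst x - fst y) * B (map_prod prod.swap prod.swap (x, y)) +
      (snd x - snd y) * A (map_prod prod.swap prod.swap (x, y))" for x y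
    using diff[of "prod.swap x" "prod.swap y"] by auto
qed (use pos_A pos_B zero in fastforce)+

lemma above_snd: "0 \<le> b \<Longrightarrow> b < b' \<Longrightarrow> Th (a, b) \<ge> c \<Longrightarrow> Th (a, b') > c"
  using level_curve.above_fst[OF swapped, of b b' a] by simp

lemma level_unique: "0 \<le> b \<Longrightarrow> 0 \<le> b' \<Longrightarrow> Th (a, b) = c \<Longrightarrow> Th (a, b') = c \<Longrightarrow> b = b'"
  using above_snd[of b b' a] above_snd[of b' b a] by (cases b b' rule: linorder_cases) auto

lemma level_between:
  assumes "0 \<le> a" "0 \<le> b" "Th (a, b) > c"
  obtains b' where "0 < b'" "b' < b" "Th (a, b') = c"
proof -
  obtain b' where "0 \<le> b'" "b' \<le> b" "Th (a, b') = c"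
    using IVT'[of "\<lambda>b. Th (a, b)" 0 c b] axis_fst[of a] assms cont_snd by auto
  moreover have "b' \<noteq> 0" "b' \<noteq> b"
    using axis_fst[of a] assms calculation by auto
  ultimately show thesis using that[of b'] by linarith
qed

definition dom :: "real set" where "dom = {a. 0 \<le> a \<and> (\<exists>b\<ge>0. Th (a, b) = c)}"

text \<open>The description is proper on \<open>dom\<close> by \<open>level_unique\<close>;
  elsewhere the value is unspecified.\<close>

definition curve :: "real \<Rightarrow> real" where "curve a = (THE b. 0 \<le> b \<and> Th (a, b) = c)"

lemma curve_eq: "0 \<le> b \<Longrightarrow> Th (a, b) = c \<Longrightarrow> curve a = b"
  unfolding curve_def using level_unique by blast

lemma curve_level: assumes "a \<in> dom" shows "curve a > 0" "Th (a, curve a) = c" "a > 0"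
proof -
  obtain b where b: "0 \<le> a" "b \<ge> 0" "Th (a, b) = c" using assms by (auto simp: dom_def)
  then have "curve a = b" by (simp add: curve_eq)
  moreover have "b > 0" using pos_B[OF b(3)] b(2) by (cases "b = 0") auto
  moreover have "a > 0" using pos_A[OF b(3)] b(1) by (cases "a = 0") auto
  ultimately show "curve a > 0" "Th (a, curve a) = c" "a > 0" using b by auto
qed

text \<open>Moving right from the curve lifts \<open>Th\<close> above c, while on the axis
  underneath it is below c. The level is met strictly in between, which gives upward closure and
  strict decrease together.\<close>

lemma dom_upward:
  assumes "a \<in> dom" "a < a'" shows "a' \<in> dom" "curve a' < curve a"
proof -
  note a = curve_level[OF assms(1)]
  have "Th (a', curve a) > c" using above_fst[of a a'] a assms(2) by auto
  then obtain b where b: "0 < b" "b < curve a" "Th (a', b) = c"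
    using level_between[of a' "curve a"] a assms(2) by auto
  then show "a' \<in> dom" "curve a' < curve a"
    using a(3) assms(2) curve_eq[of b a'] by (auto simp: dom_def intro!: exI[of _ b])
qed

lemma eventually_level:
  assumes "Th (a, b) > c" shows "eventually (\<lambda>x. Th (x, b) > c) (at a)"
proof -
  have "((\<lambda>x. Th (x, b)) \<longlongrightarrow> Th (a, b)) (at a)"
    using cont_fst[of UNIV b] by (auto simp: continuous_on_eq_continuous_at isCont_def)
  then show ?thesis using assms by (rule order_tendstoD)
qed

text \<open>One unit above the curve \<open>Th\<close> exceeds c, and this open condition survives a
  small move to the left. So \<open>dom\<close> has no least element, which makes the half-line
  open.\<close>

lemma dom_downward:
  assumes "a \<in> dom" shows "\<exists>a'<a. a' \<in> dom"
proof -
  note a = curve_level[OF assms(1)]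
  have "Th (a, curve a + 1) > c" using above_snd[of "curve a"] a by auto
  from eventually_level[OF this] obtain d where d: "d > 0"
    "\<And>x. x \<noteq> a \<Longrightarrow> dist x a < d \<Longrightarrow> Th (x, curve a + 1) > c"
    unfolding eventually_at by auto
  \<comment> \<open>The first entry keeps x positive, the second keeps it within d of a.\<close>
  define x where "x = max (a/2) (a - d/2)"
  have x: "0 < x" "x < a" "dist x a < d" using a d by (auto simp: x_def dist_real_def)
  then have "Th (x, curve a + 1) > c" using d by auto
  then obtain b where "0 < b" "Th (x, b) = c"
    using level_between[of x "curve a + 1"] x a by auto
  then have "x \<in> dom" using x by (auto simp: dom_def intro!: exI[of _ b])
  then show ?thesis using x by blast
qed

lemma dom_eq: assumes "dom \<noteq> {}" obtains \<alpha> where "\<alpha> \<ge> 0" "dom = {\<alpha><..}"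
proof
  have bdd: "bdd_below dom" by (auto simp: dom_def)
  show "Inf dom \<ge> 0" using assms by (intro cInf_greatest) (auto simp: dom_def)
  have "a \<in> dom" if "Inf dom < a" for a
    using that dom_upward(1) by (auto simp: cInf_less_iff[OF assms bdd])
  moreover have "Inf dom < a" if "a \<in> dom" for a
    using dom_downward[OF that] cInf_lower[OF _ bdd] by fastforce
  ultimately show "dom = {Inf dom<..}" by auto
qed

lemma open_dom: "open dom"
  by (cases "dom = {}") (use dom_eq in force)+

text \<open>For a height e above (below) \<open>curve a\<close> the value \<open>Th (a, e)\<close>
  is above (below) c. This persists for nearby abscissae x, so \<open>curve x\<close> stays on the
  same side of e.\<close>

lemma isCont_curve: assumes "a \<in> dom" shows "isCont curve a"
  unfolding isCont_def
proof (rule order_tendstoI)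
  note a = curve_level[OF assms(1)]
  have ev: "eventually (\<lambda>x. x \<in> dom) (at a)"
    by (rule eventually_at_in_open'[OF open_dom assms])
  fix e assume e: "curve a < e"
  then have "Th (a, e) > c" using above_snd[of "curve a" e] a by auto
  from eventually_level[OF this] ev show "eventually (\<lambda>x. curve x < e) (at a)"
  proof eventually_elim
    case (elim x)
    then show ?case
      using level_between[of x e] curve_level[of x] curve_eq[of _ x] a e by (metis less_eq_real_def less_trans)
  qed
next
  note a = curve_level[OF assms(1)]
  have ev: "eventually (\<lambda>x. x \<in> dom) (at a)"
    by (rule eventually_at_in_open'[OF open_dom assms])
  fix e assume e: "e < curve a"
  show "eventually (\<lambda>x. e < curve x) (at a)"
  proof (cases "e < 0")
    \<comment> \<open>Negative heights are out of reach of \<open>above_snd\<close>; there the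
      positivity of the curve is enough.\<close>
    case True
    show ?thesis using ev by eventually_elim (use True curve_level(1) in fastforce)
  next
    case False
    have "Th (a, e) < c"
      using above_snd[of e "curve a" a] a e False by (cases "Th (a, e) < c") auto
    moreover have "((\<lambda>x. Th (x, e)) \<longlongrightarrow> Th (a, e)) (at a)"
      using cont_fst[of UNIV e] by (auto simp: continuous_on_eq_continuous_at isCont_def)
    ultimately have "eventually (\<lambda>x. Th (x, e) < c) (at a)" by (rule order_tendstoD(2)[rotated])
    with ev show ?thesis
    proof eventually_elim
      case (elim x)
      show ?case
      proof (rule ccontr)
        assume "\<not> e < curve x"
        then show False
          using curve_level[OF elim(1)] elim(2) above_snd[of "curve x" e x]
          by (cases "curve x = e") auto
      qed
    qed
  qed
qed

definition curve' :: "real \<Rightarrow> real" where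
  "curve' a = - A ((a, curve a), (a, curve a)) / B ((a, curve a), (a, curve a))"

lemma pos_B_curve: "a \<in> dom \<Longrightarrow> B ((a, curve a), (a, curve a)) > 0"
  using curve_level[of a] pos_B[of "(a, curve a)"] by (auto simp: zero_less_mult_iff)

text \<open>\<open>Th\<close> is constant along the curve, so \<open>diff\<close> expresses the
  difference quotient exactly as -A/B at the pair of points. The limit then follows from the
  continuity of \<open>A\<close>, \<open>B\<close> and \<open>curve\<close>.\<close>

lemma DERIV_curve: assumes "a \<in> dom" shows "(curve has_real_derivative curve' a) (at a)"
proof -
  let ?z = "\<lambda>x. ((x, curve x), (a, curve a))"
  have lim: "(?z \<longlongrightarrow> ?z a) (at a)"
    using isCont_curve[OF assms] unfolding isCont_def by (intro tendsto_intros)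
  have cont: "isCont A (?z a)" "isCont B (?z a)"
    using cont_A cont_B by (auto simp: continuous_on_eq_continuous_at)
  have limA: "((\<lambda>x. A (?z x)) \<longlongrightarrow> A (?z a)) (at a)" and limB: "((\<lambda>x. B (?z x)) \<longlongrightarrow> B (?z a)) (at a)"
    using isCont_tendsto_compose[OF cont(1) lim] isCont_tendsto_compose[OF cont(2) lim] by auto
  have "((\<lambda>x. - A (?z x) / B (?z x)) \<longlongrightarrow> - A (?z a) / B (?z a)) (at a)"
    using pos_B_curve[OF assms] by (intro tendsto_intros limA limB) auto
  moreover have "eventually (\<lambda>x. B (?z x) > 0) (at a)"
    using order_tendstoD(1)[OF limB] pos_B_curve[OF assms] by auto
  then have "eventually (\<lambda>x. - A (?z x) / B (?z x) = (curve x - curve a) / (x - a)) (at a)"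
    using eventually_at_in_open'[OF open_dom assms] eventually_neq_at_within[of a a UNIV]
  proof eventually_elim
    case (elim x)
    have "Th (x, curve x) - Th (a, curve a) = 0"
      using curve_level[OF assms] curve_level[OF elim(2)] by simp
    then have "(curve x - curve a) * B (?z x) = - A (?z x) * (x - a)"
      by (simp add: diff algebra_simps)
    then show ?case using elim by (auto simp: divide_simps mult.commute)
  qed
  ultimately show ?thesis
    unfolding has_field_derivative_iff curve'_def
    by (rule Lim_transform_eventually)
qed

lemma C1_curve: "curve C1_differentiable_on dom"
proof -
  have c: "continuous_on dom curve"
    using isCont_curve by (auto intro!: continuous_at_imp_continuous_on)
  have "continuous_on dom curve'"
    unfolding curve'_def using pos_B_curve
    by (intro continuous_intros continuous_on_compose2[OF cont_A] continuous_on_compose2[OF cont_B]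
        c) fastforce+
  then show ?thesis
    using DERIV_curve unfolding C1_differentiable_on_def
      has_real_derivative_iff_has_vector_derivative by blast
qed

end

text \<open>The swapped instance describes the same level set as a graph over the other axis: its
  \<open>curve\<close> is the inverse map, its \<open>dom\<close> is the range, and it is C^1 for
  the same reason.\<close>

theorem (in level_curve) level_set_quadrant:
  assumes "\<exists>x\<in>{0..} \<times> {0..}. Th x = c"
  obtains \<alpha> \<beta> f g where "\<alpha> \<ge> 0" "\<beta> \<ge> 0" "C1_inverses f g {\<alpha><..} {\<beta><..}"
    "strict_antimono_on {\<alpha><..} f"
    "{x\<in>{0..} \<times> {0..}. Th x = c} = {(a, f a) | a. a \<in> {\<alpha><..}}"
proof -
  interpret s: level_curve "\<lambda>x. Th (prod.swap x)" "\<lambda>z. B (map_prod prod.swap prod.swap z)"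
    "\<lambda>z. A (map_prod prod.swap prod.swap z)" c
    by (rule swapped)
  have "dom \<noteq> {}" "s.dom \<noteq> {}" using assms by (auto simp: dom_def s.dom_def)
  then obtain \<alpha> \<beta> where ab: "\<alpha> \<ge> 0" "dom = {\<alpha><..}" "\<beta> \<ge> 0" "s.dom = {\<beta><..}"
    using dom_eq s.dom_eq by metis
  have 1: "curve a \<in> s.dom \<and> s.curve (curve a) = a" if "a \<in> dom" for a
    using curve_level[OF that] by (auto simp: s.dom_def intro!: exI[of _ a] s.curve_eq)
  have 2: "s.curve a \<in> dom \<and> curve (s.curve a) = a" if "a \<in> s.dom" for a
    using s.curve_level[OF that] by (auto simp: dom_def intro!: exI[of _ a] curve_eq)
  show thesis
  proof
    show "C1_inverses curve s.curve {\<alpha><..} {\<beta><..}"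
      unfolding C1_inverses_def using 1 2 C1_curve s.C1_curve ab by metis
    show "strict_antimono_on {\<alpha><..} curve"
      using dom_upward(2) ab by (auto simp: monotone_on_def)
    show "{x\<in>{0..} \<times> {0..}. Th x = c} = {(a, curve a) | a. a \<in> {\<alpha><..}}"
      unfolding ab(2)[symmetric]
    proof (intro equalityI subsetI)
      fix x assume "x \<in> {x\<in>{0..} \<times> {0..}. Th x = c}"
      then have "fst x \<in> dom \<and> x = (fst x, curve (fst x))"
        using curve_eq[of "snd x" "fst x"] by (auto simp: dom_def)
      then show "x \<in> {(a, curve a) | a. a \<in> dom}" by blast
    qed (use curve_level in fastforce)
  qed (use ab in auto)
qed


section \<open>Linear equations, parameter integrals and Picard iteration\<close>

text \<open>Variation of constants: the integrating factor exp (-S) gives (exp (-S) d)' = exp (-S)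
  h.\<close>

lemma linear_ode_solution:
  fixes d s h :: "real \<Rightarrow> real"
  assumes s: "continuous_on {a..b} s" and h: "continuous_on {a..b} h"
    and d: "\<And>t. t \<in> {a..b} \<Longrightarrow> (d has_real_derivative s t * d t + h t) (at t within {a..b})"
    and t: "t \<in> {a..b}"
  shows "d t = exp (integral {a..t} s) *
    (d a + integral {a..t} (\<lambda>r. exp (- integral {a..r} s) * h r))"
proof -
  define S where "S r = integral {a..r} s" for r
  define g where "g r = exp (- S r) * h r" for r
  have S: "(S has_real_derivative s r) (at r within {a..b})" if "r \<in> {a..b}" for r
    unfolding S_def[abs_def] by (rule integral_has_real_derivative[OF s that])
  have "((\<lambda>r. exp (- S r) * d r) has_real_derivative g r) (at r within {a..t})"
    if "r \<in> {a..t}" for r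
  proof -
    have "((\<lambda>r. exp (- S r) * d r) has_real_derivative g r) (at r within {a..b})"
    proof -
      have r: "r \<in> {a..b}" using that t by auto
      show ?thesis
        by (rule derivative_eq_intros S[OF r] d[OF r] refl)+ (simp add: g_def algebra_simps)
    qed
    then show ?thesis using t by (auto intro: DERIV_subset)
  qed
  then have "(g has_integral exp (- S t) * d t - exp (- S a) * d a) {a..t}"
    using t by (intro fundamental_theorem_of_calculus)
      (auto simp: has_real_derivative_iff_has_vector_derivative)
  then have "exp (- S t) * d t = d a + integral {a..t} g"
    by (simp add: integral_unique S_def)
  then have "exp (S t) * exp (- S t) * d t = exp (S t) * (d a + integral {a..t} g)"
    by (simp add: mult.assoc)
  then show ?thesis by (simp add: S_def g_def[abs_def] flip: exp_add)
qed

text \<open>The substitution s = c + r (t - c) moves the variable endpoint into the integrand, so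
  that the domain of integration is the fixed interval \<open>{0..1}\<close>.\<close>

lemma continuous_on_indefinite_integral:
  fixes f :: "'a::topological_space \<Rightarrow> real \<Rightarrow> real"
  assumes f: "continuous_on (U \<times> {c..d}) (\<lambda>(z, t). f z t)"
  shows "continuous_on (U \<times> {c..d}) (\<lambda>(z, t). integral {c..t} (f z))"
proof -
  have fz: "continuous_on {c..d} (f z)" if "z \<in> U" for z
    using continuous_on_compose2[OF f, of "{c..d}" "\<lambda>t. (z, t)"] that
    by (force intro!: continuous_intros)
  have range: "c + r * (t - c) \<in> {c..d}" if "t \<in> {c..d}" "r \<in> {0..1}" for t r
    using that mult_left_le_one_le[of "t - c" r] by auto
  have eq: "integral {c..t} (f z) = integral {0..1} (\<lambda>r. (t - c) * f z (c + r * (t - c)))"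
    if "z \<in> U" "t \<in> {c..d}" for z t
  proof -
    have "((\<lambda>r. (t - c) *\<^sub>R f z (c + r * (t - c))) has_integral
        integral {c + 0 * (t - c)..c + 1 * (t - c)} (f z)) {0..1}"
    proof (rule has_integral_substitution[OF _ _ _ fz[OF that(1)]])
      show "(\<lambda>r. c + r * (t - c)) ` {0..1} \<subseteq> {c..d}" using range that by blast
    qed (use that in \<open>auto intro!: derivative_eq_intros\<close>)
    then have "((\<lambda>r. (t - c) * f z (c + r * (t - c))) has_integral integral {c..t} (f z)) {0..1}"
      by simp
    then show ?thesis by (rule integral_unique[symmetric])
  qed
  have "continuous_on (U \<times> {c..d})
      (\<lambda>x. integral (cbox 0 1) (\<lambda>r. (snd x - c) * f (fst x) (c + r * (snd x - c))))"
  proof (rule integral_continuous_on_param)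
    have "continuous_on ((U \<times> {c..d}) \<times> cbox 0 1)
      (\<lambda>y. (snd (fst y) - c) * (\<lambda>(z, t). f z t) (fst (fst y), c + snd y * (snd (fst y) - c)))"
      by (intro continuous_intros continuous_on_compose2[OF f]) (use range in auto)
    then show "continuous_on ((U \<times> {c..d}) \<times> cbox 0 1)
      (\<lambda>(x, r). (snd x - c) * f (fst x) (c + r * (snd x - c)))"
      by (simp add: case_prod_unfold)
  qed
  then show ?thesis
    by (rule continuous_on_eq) (use eq in auto)
qed

text \<open>The average of f' over the segment from y to x: a divided difference that stays
  continuous across the diagonal and inherits bounds on f'.\<close>

definition mean_slope :: "(real \<Rightarrow> real) \<Rightarrow> real \<Rightarrow> real \<Rightarrow> real" where
  "mean_slope f' x y = integral {0..1} (\<lambda>r. f' (y + r * (x - y)))"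

lemma mean_slope_same [simp]: "mean_slope f' x x = f' x"
  by (simp add: mean_slope_def)

lemma mean_slope_diff:
  fixes f f' :: "real \<Rightarrow> real"
  assumes "\<And>u. (f has_real_derivative f' u) (at u)"
  shows "f x - f y = (x - y) * mean_slope f' x y"
proof -
  have "((\<lambda>r. f (y + r * (x - y))) has_real_derivative (x - y) * f' (y + r * (x - y)))
      (at r within {0..1})" for r
  proof -
    have "((\<lambda>r. y + r * (x - y)) has_real_derivative x - y) (at r within {0..1})"
      by (auto intro!: derivative_eq_intros)
    from DERIV_chain2[OF assms this] show ?thesis by (simp add: mult.commute)
  qed
  then have "((\<lambda>r. (x - y) * f' (y + r * (x - y))) has_integral
      f (y + 1 * (x - y)) - f (y + 0 * (x - y))) {0..1}"
    by (intro fundamental_theorem_of_calculus)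
      (auto simp: has_real_derivative_iff_has_vector_derivative)
  then show ?thesis by (auto simp: mean_slope_def dest!: integral_unique)
qed

lemma continuous_on_mean_slope:
  assumes "continuous_on UNIV f'"
  shows "continuous_on UNIV (\<lambda>(x, y). mean_slope f' x y)"
proof -
  have "continuous_on UNIV (\<lambda>z::real \<times> real. integral (cbox 0 1) (\<lambda>r. f' (snd z + r * (fst z - snd z))))"
    by (intro integral_continuous_on_param)
      (auto simp: case_prod_unfold intro!: continuous_on_compose2[OF assms] continuous_intros)
  then show ?thesis by (simp add: mean_slope_def case_prod_unfold)
qed

lemma abs_mean_slope_le:
  assumes "continuous_on UNIV f'" "\<And>u. \<bar>f' u\<bar> \<le> K"
  shows "\<bar>mean_slope f' x y\<bar> \<le> K"
proof -
  have "norm (integral (cbox 0 1) (\<lambda>r::real. f' (y + r * (x - y)))) \<le> K * measure lborel (cbox (0::real) 1)"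
  proof (rule has_integral_bound)
    show "K \<ge> 0" using assms(2)[of 0] by linarith
    show "((\<lambda>r. f' (y + r * (x - y))) has_integral
        integral (cbox 0 1) (\<lambda>r::real. f' (y + r * (x - y)))) (cbox 0 1)"
      by (intro integrable_integral integrable_continuous continuous_on_compose2[OF assms(1)]
          continuous_intros) auto
  qed (use assms(2) in auto)
  then show ?thesis by (simp add: mean_slope_def)
qed

text \<open>The Lipschitz bound is global in x, so the iteration runs on the whole interval. Only
  existence is taken from it; uniqueness of angles comes from
  \<open>prufer_difference\<close>.\<close>

lemma picard_existence:
  fixes F :: "real \<Rightarrow> real \<Rightarrow> real"
  assumes F: "continuous_on ({a..b} \<times> UNIV) (\<lambda>(t, x). F t x)"
    and L: "L > 0" "\<And>t x y. t \<in> {a..b} \<Longrightarrow> \<bar>F t x - F t y\<bar> \<le> L * \<bar>x - y\<bar>"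
    and ab: "a \<le> b"
  obtains x where "x a = x0"
    "\<And>t. t \<in> {a..b} \<Longrightarrow> (x has_real_derivative F t (x t)) (at t within {a..b})"
proof -
  define X where "X = rec_nat (\<lambda>t. x0) (\<lambda>n y t. x0 + integral {a..t} (\<lambda>s. F s (y s)))"
  have X0: "X 0 = (\<lambda>t. x0)"
    and XS: "X (Suc n) = (\<lambda>t. x0 + integral {a..t} (\<lambda>s. F s (X n s)))" for n
    by (simp_all add: X_def)
  have contF: "continuous_on {a..b} (\<lambda>s. F s (y s))" if "continuous_on {a..b} y" for y
    using continuous_on_compose2[OF F, of "{a..b}" "\<lambda>s. (s, y s)"]
      continuous_on_Pair[OF continuous_on_id that] by auto
  have contX: "continuous_on {a..b} (X n)" for n
  proof (induction n)
    case (Suc n)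
    show ?case unfolding XS
      by (intro continuous_intros indefinite_integral_continuous_1 integrable_continuous_interval
          contF Suc)
  qed (simp add: X0)
  have intF: "(\<lambda>s. F s (y s)) integrable_on {a..t}" if "continuous_on {a..b} y" "t \<in> {a..b}" for y t
    using contF[OF that(1)] that(2)
    by (intro integrable_continuous_interval) (auto intro: continuous_on_subset)
  have "compact ((\<lambda>t. X 1 t - X 0 t) ` {a..b})"
    by (intro compact_continuous_image continuous_intros contX) auto
  then obtain M where M: "M > 0" "\<And>t. t \<in> {a..b} \<Longrightarrow> \<bar>X 1 t - X 0 t\<bar> \<le> M"
    by (force dest!: compact_imp_bounded simp: bounded_pos)
  \<comment> \<open>Weighted by exp (2 L (t - a)), the iteration contracts by 1/2 however long the
    interval is: integrating the weight with the rate L leaves the factor L / (2 L).\<close>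
  have step: "\<bar>X (Suc n) t - X n t\<bar> \<le> M * (1/2) ^ n * exp (2 * L * (t - a))" if "t \<in> {a..b}" for n t
    using that
  proof (induction n arbitrary: t)
    case 0
    have "M * 1 \<le> M * exp (2 * L * (t - a))"
      using 0 M(1) L(1) by (intro mult_left_mono) auto
    then show ?case using M(2)[OF 0] by simp
  next
    case (Suc n)
    define K where "K = M * (1/2) ^ n"
    have "K > 0" using M(1) by (simp add: K_def)
    have K: "((\<lambda>s. L * K * exp (2 * L * (s - a))) has_integral
        K/2 * exp (2 * L * (t - a)) - K/2 * exp (2 * L * (a - a))) {a..t}"
      using Suc.prems L(1)
      by (intro fundamental_theorem_of_calculus)
        (auto intro!: derivative_eq_intros
          simp: has_real_derivative_iff_has_vector_derivative[symmetric])
    have "X (Suc (Suc n)) t - X (Suc n) t = integral {a..t} (\<lambda>s. F s (X (Suc n) s) - F s (X n s))"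
      using integral_diff[OF intF[OF contX Suc.prems] intF[OF contX Suc.prems], of "Suc n" n]
      by (simp add: fun_cong[OF XS, of _ t])
    also have "norm \<dots> \<le> integral {a..t} (\<lambda>s. L * K * exp (2 * L * (s - a)))"
    proof (rule integral_norm_bound_integral)
      show "(\<lambda>s. F s (X (Suc n) s) - F s (X n s)) integrable_on {a..t}"
        by (intro integrable_diff intF contX Suc.prems)
      show "(\<lambda>s. L * K * exp (2 * L * (s - a))) integrable_on {a..t}" using K by blast
      fix s assume s: "s \<in> {a..t}"
      have "norm (F s (X (Suc n) s) - F s (X n s)) \<le> L * \<bar>X (Suc n) s - X n s\<bar>"
        using L(2) s Suc.prems by auto
      also have "\<dots> \<le> L * (K * exp (2 * L * (s - a)))"
        unfolding K_def using s Suc.prems L(1) by (intro mult_left_mono Suc.IH) auto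
      finally show "norm (F s (X (Suc n) s) - F s (X n s)) \<le> L * K * exp (2 * L * (s - a))"
        by (simp add: mult.assoc)
    qed
    also have "\<dots> \<le> K/2 * exp (2 * L * (t - a))"
      using integral_unique[OF K] \<open>K > 0\<close> by simp
    finally show ?case by (simp add: K_def)
  qed
  have "uniform_limit {a..b} (\<lambda>n t. \<Sum>i<n. X (Suc i) t - X i t)
      (\<lambda>t. \<Sum>i. X (Suc i) t - X i t) sequentially"
  proof (rule Weierstrass_m_test)
    show "summable (\<lambda>n. M * (1/2) ^ n * exp (2 * L * (b - a)))"
      by (intro summable_mult summable_mult2 summable_geometric) auto
    fix n t assume t: "t \<in> {a..b}"
    have "M * (1/2) ^ n * exp (2 * L * (t - a)) \<le> M * (1/2) ^ n * exp (2 * L * (b - a))"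
      using t M(1) L(1) by (intro mult_left_mono) auto
    then show "norm (X (Suc n) t - X n t) \<le> M * (1/2) ^ n * exp (2 * L * (b - a))"
      using step[OF t, of n] by simp
  qed
  then have "uniform_limit {a..b} (\<lambda>n t. X n t - x0) (\<lambda>t. \<Sum>i. X (Suc i) t - X i t) sequentially"
    by (simp add: sum_lessThan_telescope[of "\<lambda>i. X i _"] X0)
  from uniform_limit_add[OF this uniform_limit_const[of "\<lambda>_. x0"]]
  obtain x where x: "uniform_limit {a..b} X x sequentially" by (auto simp: fun_eq_iff)
  have contx: "continuous_on {a..b} x"
    by (rule uniform_limit_theorem[OF _ x]) (auto simp: contX)
  have eq: "x t = x0 + integral {a..t} (\<lambda>s. F s (x s))" if t: "t \<in> {a..b}" for t
  proof (rule LIMSEQ_unique)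
    show "(\<lambda>n. X (Suc n) t) \<longlonglongrightarrow> x t"
      using tendsto_uniform_limitI[OF x t] by (rule LIMSEQ_Suc)
    have u: "uniform_limit {a..t} (\<lambda>n s. F s (X n s)) (\<lambda>s. F s (x s)) sequentially"
    proof (rule uniform_limitI)
      fix e :: real assume "e > 0"
      then have "e / L > 0" using L(1) by simp
      from uniform_limitD[OF x this]
      show "\<forall>\<^sub>F n in sequentially. \<forall>s\<in>{a..t}. dist (F s (X n s)) (F s (x s)) < e"
      proof eventually_elim
        case (elim n)
        show ?case
        proof
          fix s assume "s \<in> {a..t}"
          then have s: "s \<in> {a..b}" using t by auto
          have "\<bar>F s (X n s) - F s (x s)\<bar> \<le> L * \<bar>X n s - x s\<bar>" by (rule L(2)[OF s])
          also have "\<dots> < e" using elim s L(1) by (auto simp: dist_real_def field_simps)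
          finally show "dist (F s (X n s)) (F s (x s)) < e" by (simp add: dist_real_def)
        qed
      qed
    qed
    have c: "continuous_on {a..t} (\<lambda>s. F s (X n s))" for n
      by (rule continuous_on_subset[OF contF[OF contX]]) (use t in auto)
    obtain I J where IJ: "\<And>n. ((\<lambda>s. F s (X n s)) has_integral I n) {a..t}"
      "((\<lambda>s. F s (x s)) has_integral J) {a..t}" "I \<longlonglongrightarrow> J"
      by (rule uniform_limit_integral[OF u c]) auto
    have "X (Suc n) t = x0 + I n" for n
      unfolding XS using integral_unique[OF IJ(1)[of n]] by metis
    moreover have "integral {a..t} (\<lambda>s. F s (x s)) = J"
      by (rule integral_unique[OF IJ(2)])
    moreover have "(\<lambda>n. x0 + I n) \<longlonglongrightarrow> x0 + J" by (intro tendsto_intros IJ)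
    ultimately show "(\<lambda>n. X (Suc n) t) \<longlonglongrightarrow> x0 + integral {a..t} (\<lambda>s. F s (x s))"
      by simp
  qed
  show thesis
  proof
    show "x a = x0" using eq[of a] ab by simp
    fix t assume t: "t \<in> {a..b}"
    have "((\<lambda>t. x0 + integral {a..t} (\<lambda>s. F s (x s))) has_real_derivative F t (x t))
        (at t within {a..b})"
      using integral_has_real_derivative[OF contF[OF contx] t] by (auto intro!: derivative_eq_intros)
    then show "(x has_real_derivative F t (x t)) (at t within {a..b})"
      by (rule has_field_derivative_transform_within[where d = 1]) (use eq t in auto)
  qed
qed

section \<open>The squared positive part of the sine\<close>

text \<open>Squaring removes the corner of the positive part. The squared negative part is
  \<open>pos_sin_sq (x + pi)\<close>, so one function serves both signs.\<close>

definition pos_sin_sq :: "real \<Rightarrow> real" where "pos_sin_sq x = (max (sin x) 0)\<^sup>2"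

definition pos_sin_sq' :: "real \<Rightarrow> real" where "pos_sin_sq' x = 2 * max (sin x) 0 * cos x"

lemma DERIV_pos_part_sq: "((\<lambda>u::real. (max u 0)\<^sup>2) has_real_derivative 2 * max u 0) (at u)"
proof (cases u "0::real" rule: linorder_cases)
  case less
  have "((\<lambda>u. 0) has_real_derivative 2 * max u 0) (at u)" using less by simp
  then show ?thesis
    by (rule has_field_derivative_transform_within_open[where S = "{..<0}"]) (use less in auto)
next
  case equal
  \<comment> \<open>The slope function at 0 is \<open>max z 0\<close>, because (max z 0)^2 is the
    product of z and max z 0.\<close>
  have "isCont (\<lambda>z::real. max z 0) 0" by (intro continuous_intros)
  then show ?thesis unfolding CARAT_DERIV equal
    by (intro exI[of _ "\<lambda>z. max z 0"]) (auto simp: power2_eq_square max_def)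
next
  case greater
  have "((\<lambda>u. u\<^sup>2) has_real_derivative 2 * max u 0) (at u)"
    using greater by (auto intro!: derivative_eq_intros)
  then show ?thesis
    by (rule has_field_derivative_transform_within_open[where S = "{0<..}"]) (use greater in auto)
qed

lemma DERIV_pos_sin_sq: "(pos_sin_sq has_real_derivative pos_sin_sq' x) (at x)"
  unfolding pos_sin_sq_def[abs_def] pos_sin_sq'_def
  by (rule DERIV_chain2[OF DERIV_pos_part_sq DERIV_sin])

lemma continuous_on_pos_sin_sq [continuous_intros]:
  fixes f :: "'a::t2_space \<Rightarrow> real"
  shows
  "continuous_on S f \<Longrightarrow> continuous_on S (\<lambda>x. pos_sin_sq (f x))"
  "continuous_on S f \<Longrightarrow> continuous_on S (\<lambda>x. pos_sin_sq' (f x))"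
  unfolding pos_sin_sq_def pos_sin_sq'_def
  by (auto intro!: continuous_intros continuous_on_sin continuous_on_cos)

lemma abs_pos_sin_sq': "\<bar>pos_sin_sq' x\<bar> \<le> 2"
proof -
  have "\<bar>max (sin x) 0\<bar> * \<bar>cos x\<bar> \<le> 1 * 1"
    by (intro mult_mono) (auto simp: max_def)
  then show ?thesis by (simp add: pos_sin_sq'_def abs_mult)
qed

lemma pos_sin_sq_bounds: "0 \<le> pos_sin_sq x" "pos_sin_sq x \<le> 1"
  by (auto simp: pos_sin_sq_def max_def abs_square_le_1)

lemma pos_sin_sq_add: "pos_sin_sq x + pos_sin_sq (x + pi) = (sin x)\<^sup>2"
  by (auto simp: pos_sin_sq_def max_def)


section \<open>The Pruefer equation and comparison of angles\<close>

text \<open>For -(p u')' + q u = v u^+ - w u^- the angle obeys \<theta>' = (cos \<theta>)^2 / p + (v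
  - q) (sin^+ \<theta>)^2 + (w - q) (sin^- \<theta>)^2. Writing cos^2 as 1 - sin^2 gives this form
  with r = 1/p and Q = 1/p + q.\<close>

definition prufer_field :: "(real \<Rightarrow> real) \<Rightarrow> (real \<Rightarrow> real) \<Rightarrow> (real \<Rightarrow> real) \<Rightarrow> (real \<Rightarrow> real) \<Rightarrow>
    real \<Rightarrow> real \<Rightarrow> real" where
  "prufer_field r Q v w t x = r t + (v t - Q t) * pos_sin_sq x + (w t - Q t) * pos_sin_sq (x + pi)"

definition prufer_angle :: "real set \<Rightarrow> (real \<Rightarrow> real) \<Rightarrow> (real \<Rightarrow> real) \<Rightarrow> (real \<Rightarrow> real) \<Rightarrow> (real \<Rightarrow> real) \<Rightarrow>
    (real \<Rightarrow> real) \<Rightarrow> bool" where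
  "prufer_angle I r Q v w \<theta> \<longleftrightarrow>
    (\<forall>t\<in>I. (\<theta> has_real_derivative prufer_field r Q v w t (\<theta> t)) (at t within I))"

lemma prufer_angle_continuous: "prufer_angle I r Q v w \<theta> \<Longrightarrow> continuous_on I \<theta>"
  unfolding prufer_angle_def by (intro DERIV_continuous_on) blast

lemma prufer_angle_subset: "prufer_angle I r Q v w \<theta> \<Longrightarrow> J \<subseteq> I \<Longrightarrow> prufer_angle J r Q v w \<theta>"
  unfolding prufer_angle_def by (meson DERIV_subset subsetD)

text \<open>A shift by pi is u \<mapsto> -u, which exchanges the positive and the negative part and
  hence their weights.\<close>

lemma prufer_angle_add_pi:
  assumes "prufer_angle I r Q v w \<theta>"
  shows "prufer_angle I r Q w v (\<lambda>t. \<theta> t + pi)"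
proof -
  have "pos_sin_sq (x + pi + pi) = pos_sin_sq x" for x
    unfolding pos_sin_sq_def sin_periodic_pi by simp
  then show ?thesis
    using assms by (auto simp: prufer_angle_def prufer_field_def algebra_simps
      intro!: derivative_eq_intros)
qed

lemma prufer_angle_diff_pi:
  assumes "prufer_angle I r Q v w \<theta>"
  shows "prufer_angle I r Q w v (\<lambda>t. \<theta> t - pi)"
proof -
  have "pos_sin_sq (x - pi) = pos_sin_sq (x + pi)" for x
    by (simp add: pos_sin_sq_def)
  then show ?thesis
    using assms by (auto simp: prufer_angle_def prufer_field_def algebra_simps
      intro!: derivative_eq_intros)
qed

definition prufer_slope :: "(real \<Rightarrow> real) \<Rightarrow> (real \<Rightarrow> real) \<Rightarrow> (real \<Rightarrow> real) \<Rightarrow>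
    real \<Rightarrow> real \<Rightarrow> real \<Rightarrow> real" where
  "prufer_slope Q v w t x y = (v t - Q t) * mean_slope pos_sin_sq' x y +
    (w t - Q t) * mean_slope pos_sin_sq' (x + pi) (y + pi)"

text \<open>The weights are exchanged at the fixed angle x; the angle is then moved under the
  weights v', w'. Hence the squares in \<open>A\<close> and \<open>B\<close> follow the first angle,
  while the slope uses the second pair of weights.\<close>

lemma prufer_field_diff:
  "prufer_field r Q v w t x - prufer_field r Q v' w' t y =
    prufer_slope Q v' w' t x y * (x - y) +
    ((v t - v' t) * pos_sin_sq x + (w t - w' t) * pos_sin_sq (x + pi))"
proof -
  have 1: "pos_sin_sq x = pos_sin_sq y + (x - y) * mean_slope pos_sin_sq' x y" for x y
    using mean_slope_diff[OF DERIV_pos_sin_sq, of x y] by simp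
  show ?thesis
    unfolding prufer_field_def prufer_slope_def 1[of x y] 1[of "x + pi" "y + pi"]
    by (simp add: algebra_simps)
qed

lemma continuous_on_mean_slope_pos_sin_sq [continuous_intros]:
  fixes f g :: "'a::topological_space \<Rightarrow> real"
  assumes "continuous_on S f" "continuous_on S g"
  shows "continuous_on S (\<lambda>x. mean_slope pos_sin_sq' (f x) (g x))"
proof -
  have "continuous_on UNIV pos_sin_sq'"
    using continuous_on_pos_sin_sq(2)[OF continuous_on_id] by simp
  from continuous_on_compose2[OF continuous_on_mean_slope[OF this], of S "\<lambda>x. (f x, g x)"]
  show ?thesis using assms by (auto intro!: continuous_intros)
qed

lemma abs_mean_slope_pos_sin_sq: "\<bar>mean_slope pos_sin_sq' x y\<bar> \<le> 2"
  using continuous_on_pos_sin_sq(2)[OF continuous_on_id] abs_pos_sin_sq'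
  by (intro abs_mean_slope_le) auto

text \<open>With the mean slope as coefficient the difference of two angles solves d' = s d + h
  exactly, although the angle equation is nonlinear. Equal weights and equal initial values give
  uniqueness.\<close>

lemma prufer_difference:
  assumes cont: "continuous_on {a..b} Q" "continuous_on {a..b} v" "continuous_on {a..b} w"
      "continuous_on {a..b} v'" "continuous_on {a..b} w'"
    and \<theta>: "prufer_angle {a..b} r Q v w \<theta>" and \<eta>: "prufer_angle {a..b} r Q v' w' \<eta>"
    and t: "t \<in> {a..b}"
  defines "s \<equiv> \<lambda>t. prufer_slope Q v' w' t (\<theta> t) (\<eta> t)"
    and "h \<equiv> \<lambda>t. (v t - v' t) * pos_sin_sq (\<theta> t) + (w t - w' t) * pos_sin_sq (\<theta> t + pi)"
  shows "\<theta> t - \<eta> t = exp (integral {a..t} s) *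
      ((\<theta> a - \<eta> a) + integral {a..t} (\<lambda>r. exp (- integral {a..r} s) * h r))"
    and "continuous_on {a..b} s" and "continuous_on {a..b} h"
proof -
  note c = cont prufer_angle_continuous[OF \<theta>] prufer_angle_continuous[OF \<eta>]
  show s: "continuous_on {a..b} s" and h: "continuous_on {a..b} h"
    unfolding s_def h_def prufer_slope_def by (intro continuous_intros c)+
  show "\<theta> t - \<eta> t = exp (integral {a..t} s) *
      ((\<theta> a - \<eta> a) + integral {a..t} (\<lambda>r. exp (- integral {a..r} s) * h r))"
  proof (rule linear_ode_solution[OF s h _ t])
    fix t assume t: "t \<in> {a..b}"
    have "((\<lambda>t. \<theta> t - \<eta> t) has_real_derivative
        prufer_field r Q v w t (\<theta> t) - prufer_field r Q v' w' t (\<eta> t)) (at t within {a..b})"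
      using \<theta> \<eta> t unfolding prufer_angle_def by (intro derivative_intros) auto
    then show "((\<lambda>t. \<theta> t - \<eta> t) has_real_derivative s t * (\<theta> t - \<eta> t) + h t) (at t within {a..b})"
      by (simp add: prufer_field_diff s_def h_def)
  qed
qed

text \<open>The exponentials in the solution formula are positive, so a forcing term that is
  nonnegative along \<open>\<theta>\<close> preserves the initial order.\<close>

lemma prufer_comparison:
  assumes cont: "continuous_on {a..b} Q" "continuous_on {a..b} v" "continuous_on {a..b} w"
      "continuous_on {a..b} v'" "continuous_on {a..b} w'"
    and \<theta>: "prufer_angle {a..b} r Q v w \<theta>" and \<eta>: "prufer_angle {a..b} r Q v' w' \<eta>"
    and t: "t \<in> {a..b}"
    and h: "\<And>t. t \<in> {a..b} \<Longrightarrow>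
      (v t - v' t) * pos_sin_sq (\<theta> t) + (w t - w' t) * pos_sin_sq (\<theta> t + pi) \<ge> 0"
  shows "\<theta> a \<ge> \<eta> a \<Longrightarrow> \<theta> t \<ge> \<eta> t" and "\<theta> a > \<eta> a \<Longrightarrow> \<theta> t > \<eta> t"
proof -
  note d = prufer_difference[OF cont \<theta> \<eta> t]
  let ?s = "\<lambda>t. prufer_slope Q v' w' t (\<theta> t) (\<eta> t)"
  let ?h = "\<lambda>t. (v t - v' t) * pos_sin_sq (\<theta> t) + (w t - w' t) * pos_sin_sq (\<theta> t + pi)"
  have "integral {a..t} (\<lambda>r. exp (- integral {a..r} ?s) * ?h r) \<ge> 0"
  proof (rule integral_nonneg)
    have "continuous_on {a..b} (\<lambda>r. exp (- integral {a..r} ?s) * ?h r)"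
      by (intro continuous_intros indefinite_integral_continuous_1 integrable_continuous_interval d)
    then show "(\<lambda>r. exp (- integral {a..r} ?s) * ?h r) integrable_on {a..t}"
      using t by (intro integrable_continuous_interval) (auto elim: continuous_on_subset)
    fix r assume "r \<in> {a..t}"
    then show "exp (- integral {a..r} ?s) * ?h r \<ge> 0"
      using h[of r] t by (intro mult_nonneg_nonneg) auto
  qed
  then show "\<theta> a \<ge> \<eta> a \<Longrightarrow> \<theta> t \<ge> \<eta> t" and "\<theta> a > \<eta> a \<Longrightarrow> \<theta> t > \<eta> t"
    using d(1) by (smt (verit, best) exp_gt_zero mult_pos_pos mult_nonneg_nonneg)+
qed

section \<open>Dependence of the angle on the parameters a and b\<close>

locale prufer_family =
  fixes T1 T2 :: real and r Q m n :: "real \<Rightarrow> real" and x0 :: real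
  assumes T: "T1 < T2"
    and cont_r: "continuous_on {T1..T2} r" and cont_Q: "continuous_on {T1..T2} Q"
    and cont_m: "continuous_on {T1..T2} m" and cont_n: "continuous_on {T1..T2} n"
begin

definition angle :: "real \<times> real \<Rightarrow> real \<Rightarrow> real" where
  "angle x = (SOME \<theta>. \<theta> T1 = x0 \<and>
    prufer_angle {T1..T2} r Q (\<lambda>t. fst x * m t) (\<lambda>t. snd x * n t) \<theta>)"

lemma angle_exists: "\<exists>\<theta>. \<theta> T1 = x0 \<and>
    prufer_angle {T1..T2} r Q (\<lambda>t. fst x * m t) (\<lambda>t. snd x * n t) \<theta>"
proof -
  let ?v = "\<lambda>t. fst x * m t" and ?w = "\<lambda>t. snd x * n t"
  have c: "continuous_on ({T1..T2} \<times> UNIV) (\<lambda>z. f (fst z))"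
    if "continuous_on {T1..T2} f" for f :: "real \<Rightarrow> real"
    by (rule continuous_on_compose2[OF that]) (auto intro!: continuous_intros)
  have F: "continuous_on ({T1..T2} \<times> UNIV) (\<lambda>(t, x). prufer_field r Q ?v ?w t x)"
    unfolding prufer_field_def case_prod_unfold
    by (intro continuous_intros c cont_r cont_Q cont_m cont_n)
  define K where "K t = \<bar>?v t - Q t\<bar> + \<bar>?w t - Q t\<bar>" for t
  have "compact (K ` {T1..T2})"
    unfolding K_def by (intro compact_continuous_image continuous_intros cont_m cont_n cont_Q) auto
  then obtain M where M: "M > 0" "\<And>t. t \<in> {T1..T2} \<Longrightarrow> K t \<le> M"
    by (force dest!: compact_imp_bounded simp: bounded_pos)
  \<comment> \<open>Mean slopes of the squared parts are at most 2 in modulus, and M bounds the sum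
    of the two coefficients.\<close>
  have "\<bar>prufer_field r Q ?v ?w t x - prufer_field r Q ?v ?w t y\<bar> \<le> (2 * M) * \<bar>x - y\<bar>"
    if t: "t \<in> {T1..T2}" for t x y
  proof -
    have "\<bar>prufer_slope Q ?v ?w t x y\<bar> \<le> \<bar>?v t - Q t\<bar> * 2 + \<bar>?w t - Q t\<bar> * 2"
      unfolding prufer_slope_def
      by (rule order_trans[OF abs_triangle_ineq])
        (auto simp only: abs_mult intro!: add_mono mult_left_mono abs_mean_slope_pos_sin_sq abs_ge_zero)
    also have "\<dots> \<le> 2 * M" using M(2)[OF t] by (simp add: K_def)
    finally show ?thesis
      by (simp only: prufer_field_diff) (simp add: abs_mult mult_right_mono)
  qed
  from picard_existence[OF F _ this] obtain \<theta> where "\<theta> T1 = x0"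
    "\<And>t. t \<in> {T1..T2} \<Longrightarrow> (\<theta> has_real_derivative prufer_field r Q ?v ?w t (\<theta> t)) (at t within {T1..T2})"
    using M(1) T by (metis less_eq_real_def mult_pos_pos zero_less_numeral)
  then show ?thesis unfolding prufer_angle_def by blast
qed

lemma angle: "angle x T1 = x0"
    "prufer_angle {T1..T2} r Q (\<lambda>t. fst x * m t) (\<lambda>t. snd x * n t) (angle x)"
  using someI_ex[OF angle_exists, folded angle_def] by auto

lemma angle_unique:
  assumes "prufer_angle {T1..T2} r Q (\<lambda>t. fst x * m t) (\<lambda>t. snd x * n t) \<theta>" "\<theta> T1 = x0"
    and "t \<in> {T1..T2}"
  shows "angle x t = \<theta> t"
  using prufer_difference(1)[OF cont_Q _ _ _ _ angle(2)[of x] assms(1,3)] cont_m cont_n angle(1) assms(2)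
  by (simp add: continuous_intros)

definition slope :: "(real \<times> real) \<times> (real \<times> real) \<Rightarrow> real \<Rightarrow> real" where
  "slope z t = prufer_slope Q (\<lambda>t. fst (snd z) * m t) (\<lambda>t. snd (snd z) * n t) t
    (angle (fst z) t) (angle (snd z) t)"

text \<open>The factor by which the linear difference equation propagates a disturbance from time t
  to T2.\<close>

definition weight :: "(real \<times> real) \<times> (real \<times> real) \<Rightarrow> real \<Rightarrow> real" where
  "weight z t = exp (integral {T1..T2} (slope z) - integral {T1..t} (slope z))"

definition A where "A z = integral {T1..T2} (\<lambda>t. weight z t * (m t * pos_sin_sq (angle (fst z) t)))"

definition B where "B z = integral {T1..T2} (\<lambda>t. weight z t * (n t * pos_sin_sq (angle (fst z) t + pi)))"

lemma cont_angle: "continuous_on {T1..T2} (angle x)"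
  by (rule prufer_angle_continuous[OF angle(2)])

lemma cont_slope: "continuous_on {T1..T2} (slope z)"
  unfolding slope_def prufer_slope_def
  by (intro continuous_intros cont_Q cont_m cont_n cont_angle)

lemma cont_weight: "continuous_on {T1..T2} (weight z)"
  unfolding weight_def
  by (intro continuous_intros indefinite_integral_continuous_1 integrable_continuous_interval cont_slope)

lemma angle_diff:
  assumes "t \<in> {T1..T2}"
  shows "angle x t - angle y t = exp (integral {T1..t} (slope (x, y))) *
    integral {T1..t} (\<lambda>s. exp (- integral {T1..s} (slope (x, y))) *
      ((fst x - fst y) * (m s * pos_sin_sq (angle x s)) +
       (snd x - snd y) * (n s * pos_sin_sq (angle x s + pi))))"
  using prufer_difference(1)[OF cont_Q _ _ _ _ angle(2)[of x] angle(2)[of y] assms]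
    cont_m cont_n angle(1)
  by (simp add: continuous_intros slope_def[abs_def] algebra_simps)

lemma angle_diff_end:
  "angle x T2 - angle y T2 = (fst x - fst y) * A (x, y) + (snd x - snd y) * B (x, y)"
proof -
  let ?f = "\<lambda>s. weight (x, y) s * (m s * pos_sin_sq (angle x s))"
  let ?g = "\<lambda>s. weight (x, y) s * (n s * pos_sin_sq (angle x s + pi))"
  have exp_diff_exp: "exp (u - v) = exp u * exp (- v)" for u v :: real
    by (simp flip: exp_add)
  have int: "?f integrable_on {T1..T2}" "?g integrable_on {T1..T2}"
    by (intro integrable_continuous_interval continuous_intros cont_weight cont_m cont_n cont_angle)+
  have "angle x T2 - angle y T2 =
      integral {T1..T2} (\<lambda>s. exp (integral {T1..T2} (slope (x, y))) * (exp (- integral {T1..s} (slope (x, y))) *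
      ((fst x - fst y) * (m s * pos_sin_sq (angle x s)) +
       (snd x - snd y) * (n s * pos_sin_sq (angle x s + pi)))))"
    using angle_diff[of T2 x y] T by simp
  also have "\<dots> = integral {T1..T2} (\<lambda>s. (fst x - fst y) * ?f s + (snd x - snd y) * ?g s)"
    unfolding weight_def exp_diff_exp by (simp add: algebra_simps)
  also have "\<dots> = (fst x - fst y) * A (x, y) + (snd x - snd y) * B (x, y)"
    using integral_add[OF integrable_on_mult_right[OF int(1), of "fst x - fst y"]
        integrable_on_mult_right[OF int(2), of "snd x - snd y"]]
    by (simp add: A_def B_def)
  finally show ?thesis .
qed

text \<open>For fixed y one constant works for all x and t: the slope of the pair involves only the
  weights of y, and mean slopes and squares are bounded whatever the angle is.\<close>

lemma angle_lipschitz: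
  "\<exists>C>0. \<forall>x. \<forall>t\<in>{T1..T2}. \<bar>angle x t - angle y t\<bar> \<le> C * (\<bar>fst x - fst y\<bar> + \<bar>snd x - snd y\<bar>)"
proof -
  have "compact ((\<lambda>t. \<bar>fst y * m t - Q t\<bar> + \<bar>snd y * n t - Q t\<bar>) ` {T1..T2})"
    by (intro compact_continuous_image continuous_intros cont_m cont_n cont_Q) auto
  then obtain K where K: "K > 0" "\<And>t. t \<in> {T1..T2} \<Longrightarrow> \<bar>fst y * m t - Q t\<bar> + \<bar>snd y * n t - Q t\<bar> \<le> K"
    by (force dest!: compact_imp_bounded simp: bounded_pos)
  have "compact ((\<lambda>t. \<bar>m t\<bar> + \<bar>n t\<bar>) ` {T1..T2})"
    by (intro compact_continuous_image continuous_intros cont_m cont_n) auto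
  then obtain M where M: "M > 0" "\<And>t. t \<in> {T1..T2} \<Longrightarrow> \<bar>m t\<bar> + \<bar>n t\<bar> \<le> M"
    by (force dest!: compact_imp_bounded simp: bounded_pos)
  define L where "L = T2 - T1"
  have "L > 0" using T by (simp add: L_def)
  have slope: "\<bar>slope (x, y) t\<bar> \<le> 2 * K" if t: "t \<in> {T1..T2}" for x t
  proof -
    have "\<bar>slope (x, y) t\<bar> \<le> \<bar>fst y * m t - Q t\<bar> * 2 + \<bar>snd y * n t - Q t\<bar> * 2"
      unfolding slope_def prufer_slope_def fst_conv snd_conv
      by (rule order_trans[OF abs_triangle_ineq])
        (auto simp only: abs_mult intro!: add_mono mult_left_mono abs_mean_slope_pos_sin_sq abs_ge_zero)
    also have "\<dots> \<le> 2 * K" using K(2)[OF t] by simp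
    finally show ?thesis .
  qed
  have int_slope: "\<bar>integral {T1..t} (slope (x, y))\<bar> \<le> 2 * K * L" if t: "t \<in> {T1..T2}" for x t
  proof -
    have "norm (integral {T1..t} (slope (x, y))) \<le> 2 * K * (t - T1)"
      using t slope by (intro integral_bound continuous_on_subset[OF cont_slope]) auto
    also have "\<dots> \<le> 2 * K * L" using t K(1) by (intro mult_left_mono) (auto simp: L_def)
    finally show ?thesis by simp
  qed
  define C where "C = exp (2 * K * L) * (exp (2 * K * L) * M * L)"
  have "\<bar>angle x t - angle y t\<bar> \<le> C * (\<bar>fst x - fst y\<bar> + \<bar>snd x - snd y\<bar>)"
    if t: "t \<in> {T1..T2}" for x t
  proof -
    define d where "d = \<bar>fst x - fst y\<bar> + \<bar>snd x - snd y\<bar>"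
    have "d \<ge> 0" by (simp add: d_def)
    let ?h = "\<lambda>s. (fst x - fst y) * (m s * pos_sin_sq (angle x s)) +
       (snd x - snd y) * (n s * pos_sin_sq (angle x s + pi))"
    let ?g = "\<lambda>s. exp (- integral {T1..s} (slope (x, y))) * ?h s"
    have h: "\<bar>?h s\<bar> \<le> M * d" if s: "s \<in> {T1..T2}" for s
    proof -
      have "\<bar>m s * pos_sin_sq (angle x s)\<bar> \<le> M * 1" "\<bar>n s * pos_sin_sq (angle x s + pi)\<bar> \<le> M * 1"
        unfolding abs_mult using M(2)[OF s] M(1) pos_sin_sq_bounds by (intro mult_mono; simp)+
      then have "\<bar>?h s\<bar> \<le> \<bar>fst x - fst y\<bar> * M + \<bar>snd x - snd y\<bar> * M"
        by (intro order_trans[OF abs_triangle_ineq])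
          (auto simp only: abs_mult intro!: add_mono mult_left_mono)
      then show ?thesis by (simp add: d_def algebra_simps)
    qed
    have g: "\<bar>?g s\<bar> \<le> exp (2 * K * L) * (M * d)" if s: "s \<in> {T1..T2}" for s
      unfolding abs_mult using h[OF s] int_slope[OF s, of x] by (intro mult_mono) auto
    have "continuous_on {T1..T2} ?g"
      by (intro continuous_intros indefinite_integral_continuous_1 integrable_continuous_interval
          cont_slope cont_m cont_n cont_angle)
    then have "norm (integral {T1..t} ?g) \<le> exp (2 * K * L) * (M * d) * (t - T1)"
      using t g by (intro integral_bound) (auto elim: continuous_on_subset)
    also have "\<dots> \<le> exp (2 * K * L) * (M * d) * L"
      using t M(1) \<open>d \<ge> 0\<close> by (intro mult_left_mono) (auto simp: L_def)
    finally have i: "\<bar>integral {T1..t} ?g\<bar> \<le> exp (2 * K * L) * (M * d) * L" by simp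
    have "\<bar>angle x t - angle y t\<bar> = exp (integral {T1..t} (slope (x, y))) * \<bar>integral {T1..t} ?g\<bar>"
      unfolding angle_diff[OF t, of x y] by (simp add: abs_mult)
    also have "\<dots> \<le> exp (2 * K * L) * (exp (2 * K * L) * (M * d) * L)"
      using int_slope[OF t, of x] i by (intro mult_mono) auto
    finally show ?thesis by (simp add: C_def d_def mult_ac)
  qed
  moreover have "C > 0" using M(1) \<open>L > 0\<close> by (simp add: C_def)
  ultimately show ?thesis by blast
qed

text \<open>The Lipschitz bound makes angle x t - angle y t small uniformly in t; what remains is
  angle y, continuous in t alone.\<close>

lemma cont_angle_joint: "continuous_on (UNIV \<times> {T1..T2}) (\<lambda>z. angle (fst z) (snd z))"
  unfolding continuous_on_def
proof
  fix z :: "(real \<times> real) \<times> real" assume "z \<in> UNIV \<times> {T1..T2}"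
  then obtain y s where z: "z = (y, s)" "s \<in> {T1..T2}" by (cases z) auto
  let ?F = "at z within UNIV \<times> {T1..T2}"
  obtain C where C: "C > 0"
    "\<And>x t. t \<in> {T1..T2} \<Longrightarrow> \<bar>angle x t - angle y t\<bar> \<le> C * (\<bar>fst x - fst y\<bar> + \<bar>snd x - snd y\<bar>)"
    using angle_lipschitz by blast
  have ev: "eventually (\<lambda>w. snd w \<in> {T1..T2}) ?F"
    unfolding eventually_at_filter by (intro always_eventually) auto
  have "continuous_on (UNIV \<times> {T1..T2}) (\<lambda>w::(real\<times>real)\<times>real. angle y (snd w))"
    by (rule continuous_on_compose2[OF cont_angle]) (auto intro!: continuous_intros)
  then have 1: "((\<lambda>w. angle y (snd w)) \<longlongrightarrow> angle y s) ?F"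
    using \<open>z \<in> _\<close> z(1) unfolding continuous_on_def by (metis snd_conv)
  have "((\<lambda>w. C * (\<bar>fst (fst w) - fst y\<bar> + \<bar>snd (fst w) - snd y\<bar>)) \<longlongrightarrow>
      C * (\<bar>fst (fst z) - fst y\<bar> + \<bar>snd (fst z) - snd y\<bar>)) ?F"
    by (intro tendsto_intros)
  then have 2: "((\<lambda>w. C * (\<bar>fst (fst w) - fst y\<bar> + \<bar>snd (fst w) - snd y\<bar>)) \<longlongrightarrow> 0) ?F"
    using z by simp
  have "((\<lambda>w. angle (fst w) (snd w) - angle y (snd w)) \<longlongrightarrow> 0) ?F"
    by (rule Lim_null_comparison[OF _ 2]) (use ev in \<open>eventually_elim, use C in auto\<close>)
  from tendsto_add[OF this 1]
  show "((\<lambda>z. angle (fst z) (snd z)) \<longlongrightarrow> angle (fst z) (snd z)) ?F"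
    using z by simp
qed

lemma cont_angle_comp [continuous_intros]:
  fixes f :: "'a::topological_space \<Rightarrow> real \<times> real" and g :: "'a \<Rightarrow> real"
  assumes "continuous_on S f" "continuous_on S g" "\<And>x. x \<in> S \<Longrightarrow> g x \<in> {T1..T2}"
  shows "continuous_on S (\<lambda>x. angle (f x) (g x))"
  using continuous_on_compose2[OF cont_angle_joint continuous_on_Pair[OF assms(1,2)]] assms(3)
  by (simp add: image_subset_iff)

lemma cont_weight_joint: "continuous_on (UNIV \<times> {T1..T2}) (\<lambda>(z, t). weight z t)"
proof -
  have c: "continuous_on (UNIV \<times> {T1..T2}) (\<lambda>z::((real\<times>real)\<times>(real\<times>real))\<times>real. f (snd z))"
    if "continuous_on {T1..T2} f" for f :: "real \<Rightarrow> real"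
    by (rule continuous_on_compose2[OF that]) (auto intro!: continuous_intros)
  have "continuous_on (UNIV \<times> {T1..T2}) (\<lambda>(z, t). slope z t)"
    unfolding slope_def prufer_slope_def case_prod_unfold
    by (intro continuous_intros c cont_Q cont_m cont_n) auto
  from continuous_on_indefinite_integral[OF this]
  have i: "continuous_on (UNIV \<times> {T1..T2}) (\<lambda>(z, t). integral {T1..t} (slope z))" .
  have "continuous_on (UNIV \<times> {T1..T2}) (\<lambda>w. integral {T1..T2} (slope (fst w)))"
    using continuous_on_compose2[OF i continuous_on_Pair[OF continuous_on_fst[OF continuous_on_id]
        continuous_on_const[of _ T2]]] T
    by (simp add: image_subset_iff)
  with i show ?thesis
    unfolding weight_def case_prod_unfold by (intro continuous_intros)
qed

lemma cont_A: "continuous_on UNIV A" and cont_B: "continuous_on UNIV B"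
proof -
  have c: "continuous_on (UNIV \<times> {T1..T2}) (\<lambda>z::((real\<times>real)\<times>(real\<times>real))\<times>real. f (snd z))"
    if "continuous_on {T1..T2} f" for f :: "real \<Rightarrow> real"
    by (rule continuous_on_compose2[OF that]) (auto intro!: continuous_intros)
  note w = cont_weight_joint[unfolded case_prod_unfold]
  show "continuous_on UNIV A"
    unfolding A_def[abs_def] cbox_interval[symmetric]
    by (rule integral_continuous_on_param)
      (auto simp: case_prod_unfold intro!: continuous_intros c cont_m w)
  show "continuous_on UNIV B"
    unfolding B_def[abs_def] cbox_interval[symmetric]
    by (rule integral_continuous_on_param)
      (auto simp: case_prod_unfold intro!: continuous_intros c cont_n w)
qed

end


section \<open>Zeros, polar form and the tested equation\<close>

lemma sin_eq_0_floor: "sin x = 0 \<Longrightarrow> x = of_int \<lfloor>x / pi\<rfloor> * pi"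
  by (auto simp: sin_zero_iff_int2)

lemma pos_sin_sq_multiple_pi: "pos_sin_sq (of_int j * pi) = 0" "pos_sin_sq (of_int j * pi + pi) = 0"
proof -
  have "sin (of_int j * pi) = 0" by (auto simp: sin_zero_iff_int2)
  then show "pos_sin_sq (of_int j * pi) = 0" "pos_sin_sq (of_int j * pi + pi) = 0"
    by (auto simp: pos_sin_sq_def)
qed

lemma pos_sin_sq_eq: "pos_sin_sq x = (max (sin x) 0)\<^sup>2" "pos_sin_sq (x + pi) = (max (- sin x) 0)\<^sup>2"
  by (auto simp: pos_sin_sq_def)

locale neumann_problem =
  fixes T1 T2 :: real and p q :: "real \<Rightarrow> real"
  assumes T: "T1 < T2"
    and cont_p: "continuous_on {T1..T2} p" and cont_q: "continuous_on {T1..T2} q"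
    and p_pos: "\<And>t. t \<in> {T1..T2} \<Longrightarrow> p t > 0"
    and q_nonneg: "\<And>t. t \<in> {T1..T2} \<Longrightarrow> q t \<ge> 0"
begin

definition r :: "real \<Rightarrow> real" where "r t = 1 / p t"
definition Q :: "real \<Rightarrow> real" where "Q t = 1 / p t + q t"

lemma r_pos: "t \<in> {T1..T2} \<Longrightarrow> r t > 0"
  using p_pos by (simp add: r_def)

lemma p_mult_r: "t \<in> {T1..T2} \<Longrightarrow> p t * r t = 1"
  using p_pos[of t] by (simp add: r_def)

lemma cont_r: "continuous_on {T1..T2} r" and cont_Q: "continuous_on {T1..T2} Q"
  unfolding r_def Q_def using p_pos
  by (auto intro!: continuous_intros cont_p cont_q) fastforce+

text \<open>At a multiple of pi both squares vanish and the field reduces to \<open>r\<close>, which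
  is positive.\<close>

lemma angle_upcrossing:
  fixes j :: int
  assumes \<theta>: "prufer_angle {T1..T2} r Q v w \<theta>" and "T1 \<le> s" "s < t" "t \<le> T2" "\<theta> s \<ge> of_int j * pi"
  shows "\<theta> t > of_int j * pi"
proof (rule upcrossing[where g = \<theta> and s = s])
  have sub: "{s..t} \<subseteq> {T1..T2}" using assms by auto
  show "continuous_on {s..t} \<theta>"
    using prufer_angle_continuous[OF \<theta>] sub by (rule continuous_on_subset)
  fix x assume x: "x \<in> {s..t}" "\<theta> x = of_int j * pi"
  have "(\<theta> has_real_derivative prufer_field r Q v w x (\<theta> x)) (at x within {s..t})"
    using prufer_angle_subset[OF \<theta> sub] x(1) unfolding prufer_angle_def by blast
  moreover have "prufer_field r Q v w x (\<theta> x) = r x"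
    by (simp add: prufer_field_def x(2) pos_sin_sq_multiple_pi)
  ultimately show "\<exists>d>0. (\<theta> has_real_derivative d) (at x within {s..t})"
    using r_pos[of x] x sub by auto
qed (use assms in auto)

text \<open>Each multiple l pi with i < l \<le> j is attained exactly once inside the interval, and
  no other is. The floor of \<theta> / pi therefore labels the zeros bijectively by
  \<open>{i<..j}\<close>.\<close>

lemma zeros_of_angle:
  fixes i j :: int
  assumes \<theta>: "prufer_angle {T1..T2} r Q v w \<theta>"
    and start: "\<theta> T1 = pi/2 + of_int i * pi" and finish: "\<theta> T2 = pi/2 + of_int j * pi"
  shows "i \<le> j" "finite {t\<in>{T1<..<T2}. sin (\<theta> t) = 0}"
    "card {t\<in>{T1<..<T2}. sin (\<theta> t) = 0} = nat (j - i)"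
proof -
  define N where "N = {t\<in>{T1<..<T2}. sin (\<theta> t) = 0}"
  define g where "g t = \<lfloor>\<theta> t / pi\<rfloor>" for t
  have g: "\<theta> t = of_int (g t) * pi" if "t \<in> N" for t
    using that sin_eq_0_floor by (auto simp: N_def g_def)
  \<comment> \<open>The offset pi/2 turns a strict inequality of angles into a non-strict one of
    integers; this is why j is counted.\<close>
  have less_pi: "of_int a * pi < pi/2 + of_int b * pi \<longleftrightarrow> a \<le> b" for a b :: int
  proof -
    have "of_int a * pi < pi/2 + of_int b * pi \<longleftrightarrow> (of_int a - 1/2 - of_int b) * pi < 0"
      by (simp add: algebra_simps)
    also have "\<dots> \<longleftrightarrow> of_int a - 1/2 - of_int b < (0::real)"
      by (simp add: mult_less_0_iff)
    also have "\<dots> \<longleftrightarrow> a \<le> b" by linarith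
    finally show ?thesis .
  qed
  have start_le: "\<theta> T1 \<ge> of_int i * pi" using start by simp
  show "i \<le> j"
    using angle_upcrossing[OF \<theta> _ T _ start_le] finish less_pi by simp
  have "inj_on g N"
  proof (rule inj_onI, rule ccontr)
    fix x y assume xy: "x \<in> N" "y \<in> N" "g x = g y" "x \<noteq> y"
    then have eq: "\<theta> x = of_int (g x) * pi" "\<theta> y = of_int (g x) * pi"
      using g[OF xy(1)] g[OF xy(2)] by simp_all
    have "T1 < x" "x < T2" "T1 < y" "y < T2" using xy by (auto simp: N_def)
    then show False
      using angle_upcrossing[OF \<theta>, of x y "g x"] angle_upcrossing[OF \<theta>, of y x "g x"] xy(4)
      unfolding eq by linarith
  qed
  moreover have "g ` N = {i<..j}"
  proof (intro equalityI subsetI)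
    fix l assume "l \<in> g ` N"
    then obtain t where t: "t \<in> N" "l = g t" by auto
    then have T': "T1 < t" "t < T2" by (auto simp: N_def)
    have "of_int i * pi < of_int l * pi"
      using angle_upcrossing[OF \<theta> _ T'(1) _ start_le] T' g[OF t(1)] t(2) by auto
    moreover have "of_int l * pi < pi/2 + of_int j * pi"
      using angle_upcrossing[OF \<theta> _ T'(2), of l] T' g[OF t(1)] t(2) finish by auto
    ultimately show "l \<in> {i<..j}" unfolding less_pi by auto
  next
    fix l assume l: "l \<in> {i<..j}"
    have "\<theta> T2 > of_int l * pi" using l unfolding finish less_pi by simp
    moreover have "\<theta> T1 < of_int l * pi"
    proof -
      have "1 * pi \<le> (of_int l - of_int i) * pi"
        using l by (intro mult_right_mono) (auto simp: of_int_diff[symmetric] simp del: of_int_diff)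
      then show ?thesis unfolding start left_diff_distrib using pi_gt_zero by linarith
    qed
    ultimately obtain t where t: "T1 \<le> t" "t \<le> T2" "\<theta> t = of_int l * pi"
      using IVT'[of \<theta> T1 "of_int l * pi" T2] T prufer_angle_continuous[OF \<theta>] by auto
    then have "t \<in> N"
      using \<open>\<theta> T2 > _\<close> \<open>\<theta> T1 < _\<close> by (cases "t = T1"; cases "t = T2") (auto simp: N_def sin_zero_iff_int2)
    moreover have "g t = l" by (simp add: g_def t)
    ultimately show "l \<in> g ` N" by blast
  qed
  ultimately have "bij_betw g N {i<..j}" by (simp add: bij_betw_def)
  then show "finite {t\<in>{T1<..<T2}. sin (\<theta> t) = 0}"
    "card {t\<in>{T1<..<T2}. sin (\<theta> t) = 0} = nat (j - i)"
    unfolding N_def[symmetric]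
    by (auto simp: bij_betw_finite dest: bij_betw_same_card)
qed

text \<open>The radius normalised at T1: R'/R is minus half the derivative of the field with respect
  to the angle. Hence R^2 agrees up to a constant factor with \<open>weight\<close> on the
  diagonal.\<close>

definition amplitude :: "(real \<Rightarrow> real) \<Rightarrow> (real \<Rightarrow> real) \<Rightarrow> (real \<Rightarrow> real) \<Rightarrow> real \<Rightarrow> real" where
  "amplitude v w \<theta> t = exp (- integral {T1..t} (\<lambda>t. prufer_slope Q v w t (\<theta> t) (\<theta> t)) / 2)"

lemma amplitude_pos: "amplitude v w \<theta> t > 0"
  by (simp add: amplitude_def)

lemma amplitude_start: "amplitude v w \<theta> T1 = 1"
  by (simp add: amplitude_def)

lemma polar_derivatives:
  assumes cont: "continuous_on {T1..T2} v" "continuous_on {T1..T2} w"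
    and \<theta>: "prufer_angle {T1..T2} r Q v w \<theta>" and t: "t \<in> {T1..T2}"
  defines "u \<equiv> \<lambda>t. amplitude v w \<theta> t * sin (\<theta> t)" and "y \<equiv> \<lambda>t. amplitude v w \<theta> t * cos (\<theta> t)"
  shows "(u has_real_derivative r t * y t) (at t within {T1..T2})"
    and "(y has_real_derivative q t * u t - v t * max (u t) 0 + w t * max (- u t) 0) (at t within {T1..T2})"
proof -
  let ?s = "\<lambda>t. prufer_slope Q v w t (\<theta> t) (\<theta> t)"
  let ?R = "amplitude v w \<theta> t" and ?x = "\<theta> t"
  define P where "P = max (sin ?x) 0"
  define N where "N = max (- sin ?x) 0"
  have PN: "sin ?x = P - N" "P * N = 0" by (auto simp: P_def N_def max_def)
  \<comment> \<open>One of the two parts is 0, so the identities below reduce to two polynomial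
    ones.\<close>
  then have N_or_P: "N = 0 \<or> P = 0" by auto
  have cs: "(cos ?x)\<^sup>2 = 1 - (P - N)\<^sup>2" using sin_cos_squared_add[of ?x] PN by simp
  define c where "c = cos ?x * ((v t - Q t) * P - (w t - Q t) * N)"
  have "?s t = 2 * c"
    by (simp add: c_def prufer_slope_def pos_sin_sq'_def P_def N_def algebra_simps)
  then have s: "- ?s t / 2 = - c" by simp
  have f: "prufer_field r Q v w t ?x = r t + (v t - Q t) * P\<^sup>2 + (w t - Q t) * N\<^sup>2"
    by (simp add: prufer_field_def pos_sin_sq_eq P_def N_def)
  have "continuous_on {T1..T2} ?s"
    unfolding prufer_slope_def
    by (intro continuous_intros cont cont_Q prufer_angle_continuous[OF \<theta>])
  from integral_has_real_derivative[OF this t]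
  have dI: "((\<lambda>t. integral {T1..t} ?s) has_real_derivative ?s t) (at t within {T1..T2})" .
  have dR: "(amplitude v w \<theta> has_real_derivative ?R * - c) (at t within {T1..T2})"
    unfolding amplitude_def s[symmetric] by (rule derivative_eq_intros dI refl | simp)+
  have d\<theta>: "(\<theta> has_real_derivative prufer_field r Q v w t ?x) (at t within {T1..T2})"
    using \<theta> t by (simp add: prufer_angle_def)
  have "(u has_real_derivative ?R * - c * sin ?x + cos ?x * prufer_field r Q v w t ?x * ?R)
      (at t within {T1..T2})"
    unfolding u_def by (intro DERIV_mult dR DERIV_chain2[OF DERIV_sin d\<theta>])
  also have "?R * - c * sin ?x + cos ?x * prufer_field r Q v w t ?x * ?R = r t * y t"
    unfolding c_def f y_def PN(1) using N_or_P
    by (elim disjE) (simp_all add: algebra_simps power2_eq_square)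
  finally show "(u has_real_derivative r t * y t) (at t within {T1..T2})" .
  have "(y has_real_derivative ?R * - c * cos ?x + - sin ?x * prufer_field r Q v w t ?x * ?R)
      (at t within {T1..T2})"
    unfolding y_def by (intro DERIV_mult dR DERIV_chain2[OF DERIV_cos d\<theta>])
  also have "?R * - c * cos ?x + - sin ?x * prufer_field r Q v w t ?x * ?R =
      ?R * (- (cos ?x)\<^sup>2 * ((v t - Q t) * P - (w t - Q t) * N) - sin ?x * prufer_field r Q v w t ?x)"
    unfolding c_def by (simp add: algebra_simps power2_eq_square)
  also have "\<dots> = ?R * (q t * (P - N) - v t * P + w t * N)"
    unfolding f cs PN(1) using N_or_P
    by (elim disjE) (simp_all add: algebra_simps power2_eq_square Q_def r_def)
  also have "\<dots> = q t * u t - v t * max (u t) 0 + w t * max (- u t) 0"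
  proof -
    have "max (u t) 0 = ?R * P" "max (- u t) 0 = ?R * N"
      using amplitude_pos[of v w \<theta> t]
      by (auto simp: u_def P_def N_def max_def mult_le_0_iff zero_le_mult_iff)
    then show ?thesis by (simp add: u_def PN(1) algebra_simps)
  qed
  finally show "(y has_real_derivative q t * u t - v t * max (u t) 0 + w t * max (- u t) 0)
      (at t within {T1..T2})" .
qed

text \<open>The fundamental theorem of calculus tolerates finitely many exceptional points; setting
  the integrand to 0 there keeps it nonnegative everywhere.\<close>

lemma nondecreasing_off_finite:
  fixes f :: "real \<Rightarrow> real"
  assumes "finite S" "a \<le> b" "continuous_on {a..b} f"
    "\<And>t. t \<in> {a<..<b} - S \<Longrightarrow> (f has_real_derivative f' t) (at t)"
    "\<And>t. t \<in> {a<..<b} - S \<Longrightarrow> f' t \<ge> 0"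
  shows "f a \<le> f b"
proof -
  define g where "g t = (if t \<in> {a<..<b} - S then f' t else 0)" for t
  have "(g has_integral f b - f a) {a..b}"
    by (rule fundamental_theorem_of_calculus_interior_strong[OF assms(1,2) _ assms(3)])
      (use assms(4) in \<open>auto simp: g_def has_real_derivative_iff_has_vector_derivative\<close>)
  then have "0 \<le> f b - f a"
    by (rule has_integral_nonneg) (use assms(5) in \<open>auto simp: g_def\<close>)
  then show ?thesis by simp
qed

text \<open>Testing the equation with \<open>u\<^sup>+\<close>: the Neumann conditions kill the boundary terms, and
  \<open>p u' u\<^sup>+\<close> plus the primitive of \<open>v (u\<^sup>+)\<^sup>2\<close> is a nondecreasing function.\<close>

lemma weighted_square_pos:
  fixes i j :: int
  assumes cont: "continuous_on {T1..T2} v" "continuous_on {T1..T2} w"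
    and \<theta>: "prufer_angle {T1..T2} r Q v w \<theta>"
    and start: "\<theta> T1 = pi/2 + of_int i * pi" and finish: "\<theta> T2 = pi/2 + of_int j * pi"
    and t0: "t0 \<in> {T1<..<T2}" "sin (\<theta> t0) > 0" "cos (\<theta> t0) \<noteq> 0"
  shows "integral {T1..T2} (\<lambda>t. (amplitude v w \<theta> t)\<^sup>2 * (v t * pos_sin_sq (\<theta> t))) > 0"
proof -
  let ?R = "amplitude v w \<theta>"
  define u where "u t = ?R t * sin (\<theta> t)" for t
  define y where "y t = ?R t * cos (\<theta> t)" for t
  note polar = polar_derivatives[OF cont \<theta>, folded u_def y_def]
  have cu: "continuous_on {T1..T2} u" and cy: "continuous_on {T1..T2} y"
    by (rule DERIV_continuous_on, erule polar)+
  define h where "h t = v t * (max (u t) 0)\<^sup>2" for t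
  have ch: "continuous_on {T1..T2} h"
    unfolding h_def by (intro continuous_intros cu cont)
  define G where "G t = y t * max (u t) 0 + integral {T1..t} h" for t
  have cG: "continuous_on {T1..T2} G"
    unfolding G_def by (intro continuous_intros cu cy indefinite_integral_continuous_1
        integrable_continuous_interval ch)
  \<comment> \<open>The exceptional points: the positive part of u has a corner at the zeros of
    u.\<close>
  define S where "S = {t\<in>{T1<..<T2}. sin (\<theta> t) = 0}"
  have "finite S" unfolding S_def by (rule zeros_of_angle[OF \<theta> start finish])
  \<comment> \<open>Where u > 0 the weight v cancels in (y u)' + h, leaving the energy density r y^2
    + q u^2; where u < 0 nothing remains.\<close>
  define G' where "G' t = (if u t > 0 then r t * (y t)\<^sup>2 + q t * (u t)\<^sup>2 else 0)" for t
  have DG: "(G has_real_derivative G' t) (at t)" if t: "t \<in> {T1<..<T2} - S" for t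
  proof -
    have at: "at t within {T1..T2} = at t" using t by (intro at_within_interior) auto
    have tt: "t \<in> {T1..T2}" using t by auto
    note du = polar(1)[OF tt, unfolded at] and dy = polar(2)[OF tt, unfolded at]
    have dh: "((\<lambda>t. integral {T1..t} h) has_real_derivative h t) (at t)"
      using integral_has_real_derivative[OF ch tt] by (simp add: at)
    have "u t \<noteq> 0" using t amplitude_pos[of v w \<theta> t] by (auto simp: u_def S_def)
    moreover have "isCont u t" using du by (rule DERIV_isCont)
    ultimately have ev: "eventually (\<lambda>s. u s > 0) (nhds t)" if "u t > 0"
      using that order_tendstoD(1)[of u "u t" "nhds t" 0]
      by (simp add: continuous_at tendsto_at_iff_tendsto_nhds[symmetric] isCont_def)
    have ev': "eventually (\<lambda>s. u s < 0) (nhds t)" if "u t < 0"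
      using that order_tendstoD(2)[of u "u t" "nhds t" 0] \<open>isCont u t\<close>
      by (simp add: continuous_at tendsto_at_iff_tendsto_nhds[symmetric] isCont_def)
    show ?thesis
    proof (cases "u t > 0")
      case True
      have "((\<lambda>t. y t * u t + integral {T1..t} h) has_real_derivative G' t) (at t)"
        by (rule derivative_eq_intros du dy dh refl)+
          (use True in \<open>simp add: G'_def h_def algebra_simps power2_eq_square\<close>)
      moreover have ev_eq: "eventually (\<lambda>s. y s * u s + integral {T1..s} h = G s) (nhds t)"
        using ev[OF True] by eventually_elim (simp add: G_def)
      ultimately show ?thesis using DERIV_cong_ev[OF refl ev_eq refl] by blast
    next
      case False
      then have neg: "u t < 0" using \<open>u t \<noteq> 0\<close> by simp
      have "((\<lambda>t. integral {T1..t} h) has_real_derivative G' t) (at t)"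
        using dh neg by (simp add: G'_def h_def)
      moreover have ev_eq: "eventually (\<lambda>s. integral {T1..s} h = G s) (nhds t)"
        using ev'[OF neg] by eventually_elim (simp add: G_def)
      ultimately show ?thesis using DERIV_cong_ev[OF refl ev_eq refl] by blast
    qed
  qed
  have G'_nonneg: "G' t \<ge> 0" if "t \<in> {T1<..<T2} - S" for t
    using that r_pos[of t] q_nonneg[of t] by (auto simp: G'_def)
  have mono: "G a \<le> G b" if "T1 \<le> a" "a \<le> b" "b \<le> T2" for a b
    by (rule nondecreasing_off_finite[where f' = G', OF \<open>finite S\<close> that(2) continuous_on_subset[OF cG]])
      (use that DG G'_nonneg in auto)
  have R0: "?R t0 > 0" by (rule amplitude_pos)
  \<comment> \<open>\<open>q\<close> may vanish, so strictness comes from r y^2, which is positive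
    because the cosine at \<open>t0\<close> is not 0.\<close>
  have "G' t0 > 0"
    using t0 R0 r_pos[of t0] q_nonneg[of t0]
    by (auto simp: G'_def u_def y_def intro!: add_pos_nonneg)
  moreover have "(G has_real_derivative G' t0) (at t0)"
    using t0 by (intro DG) (auto simp: S_def)
  ultimately obtain d where d: "d > 0" "\<And>x. 0 < x \<Longrightarrow> x < d \<Longrightarrow> G t0 < G (t0 + x)"
    using DERIV_pos_inc_right by blast
  define x where "x = min (d/2) ((T2 - t0)/2)"
  have "0 < x" "x < d" "t0 + x \<le> T2" using d(1) t0(1) by (auto simp: x_def min_def field_simps)
  then have "G T1 < G T2"
    using mono[of T1 t0] mono[of "t0 + x" T2] d(2)[of x] t0(1) by auto
  moreover have "cos (pi/2 + of_int l * pi) = 0" for l :: int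
    by (simp add: cos_add sin_zero_iff_int2)
  then have "y T1 = 0" "y T2 = 0" by (simp_all add: y_def start finish)
  ultimately have "integral {T1..T2} h > 0" by (simp add: G_def)
  moreover have "h = (\<lambda>t. (?R t)\<^sup>2 * (v t * pos_sin_sq (\<theta> t)))"
  proof
    fix t
    have "max (u t) 0 = ?R t * max (sin (\<theta> t)) 0"
      using amplitude_pos[of v w \<theta> t] by (auto simp: u_def max_def mult_le_0_iff)
    then show "h t = (?R t)\<^sup>2 * (v t * pos_sin_sq (\<theta> t))"
      by (simp add: h_def pos_sin_sq_def power_mult_distrib)
  qed
  ultimately show ?thesis by simp
qed

end


section \<open>Correspondence between solutions and angles\<close>

context neumann_problem
begin

text \<open>Gronwall's argument: exp (-K t) times the squared distance is nonincreasing. The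
  derivatives are required in the open interval only, since \<open>neumann_solution\<close> states
  the equation only there.\<close>

lemma planar_unique:
  fixes U V U' V' :: "real \<Rightarrow> real"
  assumes cont: "continuous_on {T1..T2} v" "continuous_on {T1..T2} w"
    and c: "continuous_on {T1..T2} U" "continuous_on {T1..T2} V"
      "continuous_on {T1..T2} U'" "continuous_on {T1..T2} V'"
    and U: "\<And>t. t \<in> {T1<..<T2} \<Longrightarrow> (U has_real_derivative r t * V t) (at t)"
    and V: "\<And>t. t \<in> {T1<..<T2} \<Longrightarrow>
      (V has_real_derivative q t * U t - v t * max (U t) 0 + w t * max (- U t) 0) (at t)"
    and U': "\<And>t. t \<in> {T1<..<T2} \<Longrightarrow> (U' has_real_derivative r t * V' t) (at t)"
    and V': "\<And>t. t \<in> {T1<..<T2} \<Longrightarrow>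
      (V' has_real_derivative q t * U' t - v t * max (U' t) 0 + w t * max (- U' t) 0) (at t)"
    and start: "U T1 = U' T1" "V T1 = V' T1" and t: "t \<in> {T1..T2}"
  shows "U t = U' t" "V t = V' t"
proof -
  have "compact ((\<lambda>t. r t + q t + \<bar>v t\<bar> + \<bar>w t\<bar>) ` {T1..T2})"
    by (intro compact_continuous_image continuous_intros cont cont_r cont_q) auto
  then obtain K where K: "K > 0" "\<And>t. t \<in> {T1..T2} \<Longrightarrow> r t + q t + \<bar>v t\<bar> + \<bar>w t\<bar> \<le> K"
    by (force dest!: compact_imp_bounded simp: bounded_pos)
  define D where "D t = (U t - U' t)\<^sup>2 + (V t - V' t)\<^sup>2" for t
  define E where "E t = exp (- K * t) * D t" for t
  have "E t \<le> E T1"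
  proof (cases "t = T1")
    case False
    show ?thesis
    proof (rule DERIV_nonpos_imp_decreasing_open[where f = E])
      show "T1 \<le> t" using t by auto
      show "continuous_on {T1..t} E"
        unfolding E_def D_def using t
        by (intro continuous_intros continuous_on_subset[OF c(1)] continuous_on_subset[OF c(2)]
            continuous_on_subset[OF c(3)] continuous_on_subset[OF c(4)]) auto
      fix s assume "T1 < s" "s < t"
      then have s: "s \<in> {T1<..<T2}" "s \<in> {T1..T2}" using t by auto
      define dU where "dU = U s - U' s"
      define dV where "dV = V s - V' s"
      define dP where "dP = max (U s) 0 - max (U' s) 0"
      define dN where "dN = max (- U s) 0 - max (- U' s) 0"
      define D' where "D' = 2 * dU * (r s * dV) + 2 * dV * (q s * dU - v s * dP + w s * dN)"
      have "(D has_real_derivative D') (at s)"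
        unfolding D_def
        by (rule derivative_eq_intros U[OF s(1)] V[OF s(1)] U'[OF s(1)] V'[OF s(1)] refl)+
          (simp add: D'_def dU_def dV_def dP_def dN_def algebra_simps)
      then have "(E has_real_derivative exp (- K * s) * (D' - K * D s)) (at s)"
        unfolding E_def by (auto intro!: derivative_eq_intros simp: algebra_simps)
      moreover have "D' \<le> K * D s"
      proof -
        \<comment> \<open>Taking positive or negative parts is 1-Lipschitz, so the nonlinear terms
          are controlled by the difference of U and U'.\<close>
        have "\<bar>dP\<bar> \<le> \<bar>dU\<bar>" "\<bar>dN\<bar> \<le> \<bar>dU\<bar>" by (auto simp: dP_def dN_def dU_def max_def)
        then have vw: "\<bar>v s * dP\<bar> \<le> \<bar>v s\<bar> * \<bar>dU\<bar>" "\<bar>w s * dN\<bar> \<le> \<bar>w s\<bar> * \<bar>dU\<bar>"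
          unfolding abs_mult by (auto intro: mult_left_mono)
        have "D' = 2 * (dV * (r s * dU + q s * dU - v s * dP + w s * dN))"
          by (simp add: D'_def algebra_simps)
        also have "\<dots> \<le> 2 * (\<bar>dV\<bar> * \<bar>r s * dU + q s * dU - v s * dP + w s * dN\<bar>)"
          by (metis abs_ge_self abs_mult mult_le_cancel_left_pos zero_less_numeral)
        also have "\<bar>r s * dU + q s * dU - v s * dP + w s * dN\<bar> \<le>
            r s * \<bar>dU\<bar> + q s * \<bar>dU\<bar> + \<bar>v s\<bar> * \<bar>dU\<bar> + \<bar>w s\<bar> * \<bar>dU\<bar>"
        proof -
          have "\<bar>r s * dU\<bar> = r s * \<bar>dU\<bar>" "\<bar>q s * dU\<bar> = q s * \<bar>dU\<bar>"
            using r_pos[OF s(2)] q_nonneg[OF s(2)] by (simp_all add: abs_mult)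
          then show ?thesis using vw by linarith
        qed
        also have "\<dots> = (r s + q s + \<bar>v s\<bar> + \<bar>w s\<bar>) * \<bar>dU\<bar>" by (simp add: algebra_simps)
        also have "\<dots> \<le> K * \<bar>dU\<bar>" using K(2)[OF s(2)] by (intro mult_right_mono) auto
        finally have "D' \<le> 2 * (\<bar>dV\<bar> * (K * \<bar>dU\<bar>))" by (simp add: mult_left_mono)
        then have "D' \<le> K * (2 * \<bar>dV\<bar> * \<bar>dU\<bar>)" by (simp add: mult_ac)
        also have "2 * \<bar>dV\<bar> * \<bar>dU\<bar> \<le> D s"
          using sum_squares_bound[of "\<bar>dV\<bar>" "\<bar>dU\<bar>"] by (simp add: D_def dU_def dV_def)
        finally show ?thesis using K(1) by simp
      qed
      ultimately show "\<exists>y. (E has_real_derivative y) (at s) \<and> y \<le> 0"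
        by (intro exI conjI) (auto simp: mult_le_0_iff)
    qed
  qed simp
  also have "E T1 = 0" by (simp add: E_def D_def start)
  finally have "D t \<le> 0" by (simp add: E_def mult_le_0_iff)
  then have "D t = 0"
    using sum_power2_ge_zero[of "U t - U' t" "V t - V' t"] by (simp only: D_def)
  then show "U t = U' t" "V t = V' t" by (simp_all add: D_def sum_power2_eq_zero_iff)
qed

lemma angle_imp_solution:
  assumes cont: "continuous_on {T1..T2} v" "continuous_on {T1..T2} w"
    and \<theta>: "prufer_angle {T1..T2} r Q v w \<theta>" and bc: "cos (\<theta> T1) = 0" "cos (\<theta> T2) = 0"
    and u_def: "\<And>t. u t = amplitude v w \<theta> t * sin (\<theta> t)"
  shows "neumann_solution T1 T2 p q (\<lambda>t. v t * max (u t) 0 - w t * max (- u t) 0) u"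
proof -
  define y where "y t = amplitude v w \<theta> t * cos (\<theta> t)" for t
  note polar = polar_derivatives[OF cont \<theta>, folded u_def y_def]
  let ?v = "\<lambda>t. q t * u t - v t * max (u t) 0 + w t * max (- u t) 0"
  have cy: "continuous_on {T1..T2} y"
    by (rule DERIV_continuous_on, erule polar)
  have "((\<lambda>s. p s * (r s * y s)) has_real_derivative ?v t) (at t)" if t: "t \<in> {T1<..<T2}" for t
  proof -
    have "at t within {T1..T2} = at t" using t by (intro at_within_interior) auto
    then have "(y has_real_derivative ?v t) (at t)" using polar(2)[of t] t by auto
    then show ?thesis
      by (rule has_field_derivative_transform_within_open[where S = "{T1<..<T2}"])
        (use t p_mult_r in \<open>auto simp: mult.assoc[symmetric]\<close>)
  qed
  moreover have "continuous_on {T1..T2} (\<lambda>t. r t * y t)"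
    by (intro continuous_intros cont_r cy)
  moreover have "y T1 = 0" "y T2 = 0" using bc by (simp_all add: y_def)
  ultimately show ?thesis
    unfolding neumann_solution_def
    by (intro exI[of _ "\<lambda>t. r t * y t"] exI[of _ ?v] conjI ballI) (use polar(1) in simp_all)
qed

text \<open>The nonlinearity is positively homogeneous, so C times the polar solution solves the
  same equation when C \<ge> 0, and equal initial data identify it with u. The sign of
  \<open>u T1\<close> has to be carried by the starting angle.\<close>

lemma solution_polar:
  assumes cont: "continuous_on {T1..T2} v" "continuous_on {T1..T2} w"
    and sol: "neumann_solution T1 T2 p q (\<lambda>t. v t * max (u t) 0 - w t * max (- u t) 0) u"
    and \<theta>: "prufer_angle {T1..T2} r Q v w \<theta>" and bc: "cos (\<theta> T1) = 0"
    and C: "C \<ge> 0" "u T1 = C * sin (\<theta> T1)"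
  shows "\<And>t. t \<in> {T1..T2} \<Longrightarrow> u t = C * (amplitude v w \<theta> t * sin (\<theta> t))"
    and "C > 0 \<Longrightarrow> cos (\<theta> T2) = 0"
proof -
  obtain u' V where u': "continuous_on {T1..T2} u'"
      "\<And>t. t \<in> {T1..T2} \<Longrightarrow> (u has_real_derivative u' t) (at t within {T1..T2})"
      "u' T1 = 0" "u' T2 = 0"
    and V: "\<And>t. t \<in> {T1<..<T2} \<Longrightarrow> ((\<lambda>s. p s * u' s) has_real_derivative V t) (at t)"
      "\<And>t. t \<in> {T1<..<T2} \<Longrightarrow> - V t + q t * u t = v t * max (u t) 0 - w t * max (- u t) 0"
    using sol unfolding neumann_solution_def by blast
  define y where "y t = C * (amplitude v w \<theta> t * cos (\<theta> t))" for t
  define x where "x t = C * (amplitude v w \<theta> t * sin (\<theta> t))" for t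
  note polar = polar_derivatives[OF cont \<theta>]
  have dx: "(x has_real_derivative r t * y t) (at t within {T1..T2})" if "t \<in> {T1..T2}" for t
    unfolding x_def y_def
    using DERIV_cmult[OF polar(1)[OF that], of C] by (simp add: mult_ac)
  have scale: "max (C * z) 0 = C * max z 0" for z
    using C(1) by (auto simp: max_def mult_le_0_iff zero_le_mult_iff)
  have dy: "(y has_real_derivative q t * x t - v t * max (x t) 0 + w t * max (- x t) 0)
      (at t within {T1..T2})" if "t \<in> {T1..T2}" for t
    unfolding x_def y_def mult_minus_right[symmetric] scale
    using DERIV_cmult[OF polar(2)[OF that], of C] by (simp add: algebra_simps)
  have at: "at t within {T1..T2} = at t" if "t \<in> {T1<..<T2}" for t
    using that by (intro at_within_interior) auto
  have eq: "u t = x t" "p t * u' t = y t" if t: "t \<in> {T1..T2}" for t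
  proof -
    have cx: "continuous_on {T1..T2} x" and cy: "continuous_on {T1..T2} y"
      by (rule DERIV_continuous_on, erule dx dy)+
    have cu: "continuous_on {T1..T2} u" and cu': "continuous_on {T1..T2} (\<lambda>t. p t * u' t)"
      by (rule DERIV_continuous_on, erule u'(2)) (intro continuous_intros cont_p u'(1))
    have du: "(u has_real_derivative r s * (p s * u' s)) (at s)" if "s \<in> {T1<..<T2}" for s
    proof -
      have eq: "r s * (p s * u' s) = u' s" using p_mult_r[of s] that by (simp add: mult_ac)
      show ?thesis unfolding eq using u'(2)[of s] at[OF that] that by auto
    qed
    have dV: "((\<lambda>t. p t * u' t) has_real_derivative
        q s * u s - v s * max (u s) 0 + w s * max (- u s) 0) (at s)" if "s \<in> {T1<..<T2}" for s
    proof -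
      have "V s = q s * u s - v s * max (u s) 0 + w s * max (- u s) 0" using V(2)[OF that] by simp
      then show ?thesis using V(1)[OF that] by simp
    qed
    have dx': "(x has_real_derivative r s * y s) (at s)"
      and dy': "(y has_real_derivative q s * x s - v s * max (x s) 0 + w s * max (- x s) 0) (at s)"
      if "s \<in> {T1<..<T2}" for s
      using dx[of s] dy[of s] at[OF that] that by auto
    have st: "u T1 = x T1" "p T1 * u' T1 = y T1"
      using C bc u' by (simp_all add: x_def y_def amplitude_start)
    show "u t = x t" "p t * u' t = y t"
      using planar_unique[OF cont cu cu' cx cy du dV dx' dy' st t] by auto
  qed
  show "u t = C * (amplitude v w \<theta> t * sin (\<theta> t))" if "t \<in> {T1..T2}" for t
    using eq(1)[OF that] by (simp add: x_def)
  show "cos (\<theta> T2) = 0" if "C > 0"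
    using eq(2)[of T2] T u'(4) that amplitude_pos[of v w \<theta> T2] by (simp add: y_def)
qed

lemma angle_exists:
  assumes "continuous_on {T1..T2} v" "continuous_on {T1..T2} w"
  obtains \<theta> where "prufer_angle {T1..T2} r Q v w \<theta>" "\<theta> T1 = x0"
proof -
  interpret prufer_family T1 T2 r Q v w x0
    by unfold_locales (use T cont_r cont_Q assms in auto)
  show thesis using angle[of "(1, 1)"] that by auto
qed

lemma angle_imp_C_gt:
  assumes cont: "continuous_on {T1..T2} m" "continuous_on {T1..T2} n"
    and \<theta>: "prufer_angle {T1..T2} r Q (\<lambda>t. a * m t) (\<lambda>t. b * n t) \<theta>"
    and ends: "\<theta> T1 = pi/2 - real k * pi" "\<theta> T2 = pi/2"
  shows "(a, b) \<in> C_gt T1 T2 p q m n k"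
proof -
  let ?R = "amplitude (\<lambda>t. a * m t) (\<lambda>t. b * n t) \<theta>"
  define u where "u t = ?R t * sin (\<theta> t)" for t
  have c: "continuous_on {T1..T2} (\<lambda>t. a * m t)" "continuous_on {T1..T2} (\<lambda>t. b * n t)"
    by (intro continuous_intros cont)+
  have ends': "\<theta> T1 = pi/2 + of_int (- int k) * pi" "\<theta> T2 = pi/2 + of_int 0 * pi"
    using ends by simp_all
  have "cos (\<theta> T1) = 0" "cos (\<theta> T2) = 0" by (simp_all add: ends cos_diff)
  from angle_imp_solution[OF c \<theta> this u_def]
  have "solves_P T1 T2 p q m n a b u"
    by (simp add: solves_P_def)
  moreover have "u T2 > 0" using amplitude_pos by (simp add: u_def ends)
  moreover have "u t = 0 \<longleftrightarrow> sin (\<theta> t) = 0" for t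
    using amplitude_pos[of "\<lambda>t. a * m t" "\<lambda>t. b * n t" \<theta> t] by (simp add: u_def)
  then have "nontrivial_with_zeros T1 T2 k u"
    unfolding nontrivial_with_zeros_def
    using zeros_of_angle[OF \<theta> ends'] T \<open>u T2 > 0\<close> by (auto simp: ends intro!: bexI[of _ T2])
  ultimately show ?thesis by (auto simp: C_gt_def)
qed

lemma C_gt_imp_angle:
  assumes cont: "continuous_on {T1..T2} m" "continuous_on {T1..T2} n"
    and "(a, b) \<in> C_gt T1 T2 p q m n k"
  obtains \<theta> where "prufer_angle {T1..T2} r Q (\<lambda>t. a * m t) (\<lambda>t. b * n t) \<theta>"
    "\<theta> T1 = pi/2 - real k * pi" "\<theta> T2 = pi/2"
proof -
  let ?v = "\<lambda>t. a * m t" and ?w = "\<lambda>t. b * n t"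
  obtain u where u: "solves_P T1 T2 p q m n a b u" "nontrivial_with_zeros T1 T2 k u" "u T2 > 0"
    using assms(3) by (auto simp: C_gt_def)
  have c: "continuous_on {T1..T2} ?v" "continuous_on {T1..T2} ?w"
    by (intro continuous_intros cont)+
  note sol = u(1)[unfolded solves_P_def]
  \<comment> \<open>The sign of \<open>u T1\<close> is not yet known. The two candidate angles
    differ by pi, so the sine of one of them has that sign.\<close>
  have "\<exists>i::int. (i = - int k \<or> i = - int k - 1) \<and> u T1 = \<bar>u T1\<bar> * sin (pi/2 + of_int i * pi)"
  proof -
    have "sin (pi/2 - real k * pi - pi) = - sin (pi/2 - real k * pi)"
      by (simp only: sin_diff[of _ pi]) simp
    moreover have "sin (pi/2 - real k * pi) = 1 \<or> sin (pi/2 - real k * pi) = - 1"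
      by (cases "even k") (simp_all add: sin_diff)
    ultimately have "u T1 = \<bar>u T1\<bar> * sin (pi/2 - real k * pi) \<or>
        u T1 = \<bar>u T1\<bar> * sin (pi/2 - real k * pi - pi)" by (auto simp: abs_if)
    moreover have "pi/2 + of_int (- int k) * pi = pi/2 - real k * pi"
      "pi/2 + of_int (- int k - 1) * pi = pi/2 - real k * pi - pi" by (simp_all add: algebra_simps)
    ultimately have "u T1 = \<bar>u T1\<bar> * sin (pi/2 + of_int (- int k) * pi) \<or>
        u T1 = \<bar>u T1\<bar> * sin (pi/2 + of_int (- int k - 1) * pi)" by presburger
    then show ?thesis by blast
  qed
  then obtain i :: int where i: "i = - int k \<or> i = - int k - 1"
    "u T1 = \<bar>u T1\<bar> * sin (pi/2 + of_int i * pi)" by blast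
  obtain \<theta> where \<theta>: "prufer_angle {T1..T2} r Q ?v ?w \<theta>" "\<theta> T1 = pi/2 + of_int i * pi"
    using angle_exists[OF c] by blast
  have "cos (\<theta> T1) = 0" using sin_zero_iff_int2[of "of_int i * pi"] by (auto simp: \<theta>(2) cos_add)
  note polar = solution_polar[OF c sol \<theta>(1) this abs_ge_zero i(2)[folded \<theta>(2)]]
  have "u T1 \<noteq> 0"
    using polar(1)[of T2] u(3) T by auto
  then have pos: "\<bar>u T1\<bar> > 0" by simp
  then have "cos (\<theta> T2) = 0" by (rule polar(2))
  then obtain j :: int where j: "\<theta> T2 = pi/2 + of_int j * pi"
    unfolding cos_zero_iff_int2 by (auto simp: add.commute)
  note zeros = zeros_of_angle[OF \<theta> j]
  have "u t = 0 \<longleftrightarrow> sin (\<theta> t) = 0" if "t \<in> {T1..T2}" for t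
    unfolding polar(1)[OF that] using amplitude_pos[of ?v ?w \<theta> t] pos by simp
  then have "{t \<in> {T1<..<T2}. u t = 0} = {t \<in> {T1<..<T2}. sin (\<theta> t) = 0}" by auto
  then have "k = nat (j - i)" using u(2) zeros(3) by (simp add: nontrivial_with_zeros_def)
  then have ji: "j = i + int k" using zeros(1) by simp
  have "sin (\<theta> T2) > 0"
    using polar(1)[of T2] u(3) T pos amplitude_pos[of ?v ?w \<theta> T2] by (simp add: zero_less_mult_iff)
  \<comment> \<open>The zero count gives j = i + k, so j is 0 or -1; for j = -1 the sine at T2 would
    be negative.\<close>
  then have "j \<noteq> -1" using j by auto
  then have "j = 0" "i = - int k" using i(1) ji by auto
  then show thesis using that[OF \<theta>(1)] \<theta>(2) j by simp
qed

end


section \<open>Principal eigenvalues and linear comparison\<close>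

lemma neumann_solution_uminus:
  assumes "neumann_solution T1 T2 p q h u"
  shows "neumann_solution T1 T2 p q (\<lambda>t. - h t) (\<lambda>t. - u t)"
proof -
  obtain u' V where u': "continuous_on {T1..T2} u'"
      "\<forall>t\<in>{T1..T2}. (u has_real_derivative u' t) (at t within {T1..T2})"
      "\<forall>t\<in>{T1<..<T2}. ((\<lambda>s. p s * u' s) has_real_derivative V t) (at t) \<and> - V t + q t * u t = h t"
      "u' T1 = 0 \<and> u' T2 = 0"
    using assms unfolding neumann_solution_def by blast
  show ?thesis
    unfolding neumann_solution_def
    by (intro exI[of _ "\<lambda>t. - u' t"] exI[of _ "\<lambda>t. - V t"])
      (use u' in \<open>auto intro!: continuous_intros DERIV_minus\<close>)
qed

context neumann_problem
begin

text \<open>With both weights equal to \<open>q\<close> the constants are solutions, so the constant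
  angle is admissible. As q \<ge> 0, the angle for zero weights cannot overtake it.\<close>

lemma angle_zero_weight:
  fixes i :: int
  assumes \<theta>: "prufer_angle {T1..T2} r Q (\<lambda>t. 0) (\<lambda>t. 0) \<theta>" and "\<theta> T1 = pi/2 + of_int i * pi"
  shows "\<theta> T2 \<le> pi/2 + of_int i * pi"
proof -
  have sq: "pos_sin_sq x + pos_sin_sq (x + pi) = 1" if x: "x = pi/2 + of_int i * pi" for x
  proof -
    have "cos x = 0" using sin_zero_iff_int2[of "of_int i * pi"] by (auto simp: x cos_add)
    then show ?thesis using pos_sin_sq_add[of x] sin_cos_squared_add[of x] by simp
  qed
  have "prufer_angle {T1..T2} r Q q q (\<lambda>t. pi/2 + of_int i * pi)"
    unfolding prufer_angle_def
  proof
    fix t assume "t \<in> {T1..T2}"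
    let ?x = "pi/2 + of_int i * pi"
    have "prufer_field r Q q q t ?x = r t * (1 - (pos_sin_sq ?x + pos_sin_sq (?x + pi)))"
      by (simp add: prufer_field_def r_def Q_def algebra_simps)
    also have "\<dots> = 0" by (subst sq) auto
    finally show "((\<lambda>t. ?x) has_real_derivative prufer_field r Q q q t ?x) (at t within {T1..T2})"
      by simp
  qed
  from prufer_comparison(1)[OF cont_Q cont_q cont_q _ _ this \<theta>, of T2]
  show ?thesis
    using T assms(2) q_nonneg pos_sin_sq_bounds(1) by auto
qed

text \<open>On the last nodal interval, from \<open>s\<close> to T2, the sine of \<theta> is
  nonnegative and \<theta> solves the linear equation with weight v. The linear angle starts at
  pi/2, so it is positive at \<open>s\<close>, and strict comparison keeps it ahead.\<close>

lemma linear_angle_pos: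
  assumes cont: "continuous_on {T1..T2} v" "continuous_on {T1..T2} w"
    and \<theta>: "prufer_angle {T1..T2} r Q v w \<theta>"
    and ends: "\<theta> T1 < 0" "\<theta> T2 = pi/2"
    and \<phi>: "prufer_angle {T1..T2} r Q v v \<phi>" "\<phi> T1 = pi/2"
  shows "\<phi> T2 > pi/2"
proof -
  note up = angle_upcrossing[OF \<theta>]
  obtain s where s: "T1 \<le> s" "s \<le> T2" "\<theta> s = 0"
    using IVT'[of \<theta> T1 0 T2] T ends prufer_angle_continuous[OF \<theta>] by auto
  have s': "T1 < s" "s < T2"
    using s ends by (cases "s = T1"; cases "s = T2"; auto)+
  have range: "0 \<le> \<theta> t" "\<theta> t \<le> pi" if "t \<in> {s..T2}" for t
  proof -
    show "0 \<le> \<theta> t" using up[of s t 0] that s by (cases "s = t") auto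
    show "\<theta> t \<le> pi"
    proof (cases "t = T2")
      case False
      then show ?thesis using up[of t T2 1] that s ends pi_gt_zero by (cases "\<theta> t \<le> pi") auto
    next
      case True
      show ?thesis unfolding True ends(2) using pi_gt_zero by linarith
    qed
  qed
  have "pos_sin_sq (\<theta> t + pi) = 0" if "t \<in> {s..T2}" for t
    using sin_ge_zero[OF range[OF that]] by (simp add: pos_sin_sq_eq)
  then have "prufer_field r Q v w t (\<theta> t) = prufer_field r Q v v t (\<theta> t)" if "t \<in> {s..T2}" for t
    using that by (simp add: prufer_field_def)
  then have \<theta>': "prufer_angle {s..T2} r Q v v \<theta>"
    using prufer_angle_subset[OF \<theta>, of "{s..T2}"] s by (auto simp: prufer_angle_def)
  have "\<phi> s > \<theta> s"
    using angle_upcrossing[OF \<phi>(1) _ s'(1), of 0] s s' \<phi>(2) by auto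
  moreover have sub: "{s..T2} \<subseteq> {T1..T2}" using s by auto
  ultimately have "\<phi> T2 > \<theta> T2"
    using prufer_comparison(2)[OF _ _ _ _ _ prufer_angle_subset[OF \<phi>(1) sub] \<theta>', of T2]
      continuous_on_subset[OF cont(1) sub] continuous_on_subset[OF cont_Q sub] s by auto
  then show ?thesis using ends by simp
qed

text \<open>The comparison now runs on the nodal interval where the sine is nonpositive, ending at a
  zero \<open>s\<close> of \<theta>. The linear angle is lowered by pi to lie on that branch; beyond
  \<open>s\<close> up-crossing keeps it above 0.\<close>

lemma linear_angle_neg:
  assumes cont: "continuous_on {T1..T2} v" "continuous_on {T1..T2} w"
    and \<theta>: "prufer_angle {T1..T2} r Q v w \<theta>"
    and ends: "\<theta> T1 \<le> - pi \<or> \<theta> T1 = - pi/2" "\<theta> T2 > 0"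
    and \<psi>: "prufer_angle {T1..T2} r Q w w \<psi>" "\<psi> T1 = pi/2"
  shows "\<psi> T2 > pi/2"
proof -
  note up = angle_upcrossing[OF \<theta>]
  define \<eta> where "\<eta> t = \<psi> t - pi" for t
  have \<eta>: "prufer_angle {T1..T2} r Q w w \<eta>" "\<eta> T1 = - pi/2"
    using prufer_angle_diff_pi[OF \<psi>(1)] \<psi>(2) by (auto simp: \<eta>_def[abs_def])
  have "\<theta> T1 < 0" using ends by (auto simp: less_eq_real_def intro: less_le_trans[of _ "- pi"])
  obtain s where s: "T1 \<le> s" "s \<le> T2" "\<theta> s = 0"
    using IVT'[of \<theta> T1 0 T2] T ends \<open>\<theta> T1 < 0\<close> prufer_angle_continuous[OF \<theta>] by auto
  have s': "T1 < s" "s < T2"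
    using s ends \<open>\<theta> T1 < 0\<close> by (cases "s = T1"; cases "s = T2"; auto)+
  \<comment> \<open>The left end of the nodal interval: T1 itself if \<theta> starts at -pi/2,
    otherwise a point where \<theta> equals -pi, which \<open>\<eta>\<close>, started at -pi/2, has
    already passed.\<close>
  obtain s0 where s0: "T1 \<le> s0" "s0 < s" "\<theta> s0 \<ge> - pi" "\<eta> s0 \<ge> \<theta> s0"
  proof (cases "\<theta> T1 = - pi/2")
    case True
    then show thesis using that[of T1] s' \<eta>(2) pi_gt_zero by auto
  next
    case False
    then have "\<theta> T1 \<le> - pi" using ends by simp
    then obtain s0 where "T1 \<le> s0" "s0 \<le> s" "\<theta> s0 = - pi"
      using IVT'[of \<theta> T1 "- pi" s] s continuous_on_subset[OF prufer_angle_continuous[OF \<theta>], of "{T1..s}"]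
      by auto
    moreover have "s0 \<noteq> s" using calculation s by auto
    moreover have "\<eta> s0 \<ge> - pi"
      using angle_upcrossing[OF \<eta>(1), of T1 s0 "-1"] calculation \<eta>(2) s by (cases "s0 = T1") auto
    ultimately show thesis using that[of s0] by auto
  qed
  have range: "- pi \<le> \<theta> t" "\<theta> t \<le> 0" if "t \<in> {s0..s}" for t
  proof -
    show "- pi \<le> \<theta> t" using up[of s0 t "-1"] that s s0 by (cases "s0 = t") auto
    show "\<theta> t \<le> 0"
      using up[of t s 0] that s s0 by (cases "t = s") (auto simp: not_less[symmetric])
  qed
  have "pos_sin_sq (\<theta> t) = 0" if "t \<in> {s0..s}" for t
    using sin_ge_zero[of "- \<theta> t"] range[OF that] by (simp add: pos_sin_sq_eq)
  then have "prufer_field r Q v w t (\<theta> t) = prufer_field r Q w w t (\<theta> t)" if "t \<in> {s0..s}" for t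
    using that by (simp add: prufer_field_def)
  then have \<theta>': "prufer_angle {s0..s} r Q w w \<theta>"
    using prufer_angle_subset[OF \<theta>, of "{s0..s}"] s s0 by (auto simp: prufer_angle_def)
  have sub: "{s0..s} \<subseteq> {T1..T2}" using s s0 by auto
  have "\<eta> s \<ge> \<theta> s"
    using prufer_comparison(1)[OF _ _ _ _ _ prufer_angle_subset[OF \<eta>(1) sub] \<theta>', of s]
      continuous_on_subset[OF cont(2) sub] continuous_on_subset[OF cont_Q sub] s s0 by auto
  then have "\<eta> T2 > 0"
    using angle_upcrossing[OF \<eta>(1), of s T2 0] s s' by auto
  then show ?thesis using pi_gt_zero unfolding \<eta>_def by linarith
qed

text \<open>In polar form the Neumann condition at T2 says that the cosine vanishes, so the sine
  does not. The factor \<bar>u T1\<bar> is not 0, as u would otherwise vanish identically.\<close>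

lemma solution_end_nonzero:
  assumes cont: "continuous_on {T1..T2} v" "continuous_on {T1..T2} w"
    and sol: "neumann_solution T1 T2 p q (\<lambda>t. v t * max (u t) 0 - w t * max (- u t) 0) u"
    and nontrivial: "\<exists>t\<in>{T1..T2}. u t \<noteq> 0"
  shows "u T2 \<noteq> 0"
proof -
  obtain \<theta> where \<theta>: "prufer_angle {T1..T2} r Q v w \<theta>" "\<theta> T1 = (if u T1 \<ge> 0 then pi/2 else - (pi/2))"
    using angle_exists[OF cont] by blast
  then have 1: "cos (\<theta> T1) = 0" "u T1 = \<bar>u T1\<bar> * sin (\<theta> T1)" by (simp_all add: \<theta>(2))
  note polar = solution_polar[OF cont sol \<theta>(1) 1(1) abs_ge_zero 1(2)]
  have "u T1 \<noteq> 0"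
  proof
    assume "u T1 = 0"
    then have "u t = 0" if "t \<in> {T1..T2}" for t unfolding polar(1)[OF that] by simp
    then show False using nontrivial by blast
  qed
  moreover have "cos (\<theta> T2) = 0" using polar(2) \<open>u T1 \<noteq> 0\<close> by simp
  then have "sin (\<theta> T2) \<noteq> 0" using sin_cos_squared_add[of "\<theta> T2"] by auto
  moreover have "amplitude v w \<theta> T2 \<noteq> 0" using amplitude_pos[of v w \<theta> T2] by simp
  moreover have "u T2 = \<bar>u T1\<bar> * (amplitude v w \<theta> T2 * sin (\<theta> T2))"
    using T by (intro polar(1)) auto
  ultimately show ?thesis by simp
qed

text \<open>The linear problem is (P) with both weights equal to w, on the diagonal a = b; replacing
  u by -u where necessary makes the end value positive.\<close>

lemma principal_eigenvalue_iff:
  assumes w: "continuous_on {T1..T2} w"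
  shows "principal_eigenvalue T1 T2 p q w \<mu> \<longleftrightarrow> (\<mu>, \<mu>) \<in> C_gt T1 T2 p q w w 0"
proof
  have linear: "(\<lambda>t. \<mu> * w t * u t) = (\<lambda>t. \<mu> * w t * max (u t) 0 - \<mu> * w t * max (- u t) 0)"
    for u :: "real \<Rightarrow> real"
    by (auto simp: max_def)
  {
    assume "principal_eigenvalue T1 T2 p q w \<mu>"
    then obtain u where u: "neumann_solution T1 T2 p q (\<lambda>t. \<mu> * w t * u t) u"
      "\<forall>t\<in>{T1<..<T2}. u t \<noteq> 0"
      by (auto simp: principal_eigenvalue_def)
    have "\<exists>t\<in>{T1..T2}. u t \<noteq> 0"
      using u(2) T by (intro bexI[of _ "(T1 + T2)/2"]) auto
    then have "u T2 \<noteq> 0"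
      using w u(1) unfolding linear by (intro solution_end_nonzero) (auto intro!: continuous_intros)
    define s where "s = sgn (u T2)"
    have s: "s = 1 \<or> s = - 1" using \<open>u T2 \<noteq> 0\<close> by (auto simp: s_def sgn_if)
    have "neumann_solution T1 T2 p q (\<lambda>t. \<mu> * w t * (s * u t)) (\<lambda>t. s * u t)"
      using s u(1) neumann_solution_uminus[OF u(1)] by auto
    then have "solves_P T1 T2 p q w w \<mu> \<mu> (\<lambda>t. s * u t)"
      unfolding solves_P_def linear .
    moreover have "s * u T2 > 0" using \<open>u T2 \<noteq> 0\<close> by (auto simp: s_def sgn_if)
    moreover have no_zero: "{t \<in> {T1<..<T2}. s * u t = 0} = {}" using u(2) s by auto
    have "nontrivial_with_zeros T1 T2 0 (\<lambda>t. s * u t)"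
      unfolding nontrivial_with_zeros_def no_zero
      using T \<open>u T2 \<noteq> 0\<close> s by (intro conjI bexI[of _ T2]) auto
    ultimately show "(\<mu>, \<mu>) \<in> C_gt T1 T2 p q w w 0" by (auto simp: C_gt_def)
  }
  assume "(\<mu>, \<mu>) \<in> C_gt T1 T2 p q w w 0"
  then obtain u where u: "solves_P T1 T2 p q w w \<mu> \<mu> u" "nontrivial_with_zeros T1 T2 0 u"
    by (auto simp: C_gt_def)
  then show "principal_eigenvalue T1 T2 p q w \<mu>"
    unfolding principal_eigenvalue_def solves_P_def linear[symmetric] nontrivial_with_zeros_def
    by auto
qed

text \<open>A relation, so that the maximum is known to be attained before the operator
  \<open>GREATEST\<close> is evaluated.\<close>

definition greatest_principal :: "(real \<Rightarrow> real) \<Rightarrow> real \<Rightarrow> bool" where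
  "greatest_principal w \<mu> \<longleftrightarrow> principal_eigenvalue T1 T2 p q w \<mu> \<and>
    (\<forall>\<nu>. principal_eigenvalue T1 T2 p q w \<nu> \<longrightarrow> \<nu> \<le> \<mu>)"

lemma greatest_principal_exists:
  assumes w: "continuous_on {T1..T2} w"
    and \<alpha>: "\<alpha> \<ge> 0"
    and gt: "\<And>a \<phi>. a > \<alpha> \<Longrightarrow> prufer_angle {T1..T2} r Q (\<lambda>t. a * w t) (\<lambda>t. a * w t) \<phi> \<Longrightarrow>
      \<phi> T1 = pi/2 \<Longrightarrow> \<phi> T2 > pi/2"
  shows "\<exists>\<mu>\<le>\<alpha>. greatest_principal w \<mu>"
proof -
  interpret prufer_family T1 T2 r Q w w "pi/2"
    by unfold_locales (use T cont_r cont_Q w in auto)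
  define g where "g \<mu> = angle (\<mu>, \<mu>) T2" for \<mu>
  have cont_g: "continuous_on S g" for S
    unfolding g_def by (intro continuous_intros) (use T in auto)
  define Z where "Z = {\<mu>. g \<mu> = pi/2}"
  have Z: "principal_eigenvalue T1 T2 p q w \<mu> \<longleftrightarrow> \<mu> \<in> Z" for \<mu>
  proof
    assume "principal_eigenvalue T1 T2 p q w \<mu>"
    then have "(\<mu>, \<mu>) \<in> C_gt T1 T2 p q w w 0" by (simp add: principal_eigenvalue_iff[OF w])
    from C_gt_imp_angle[OF w w this] obtain \<theta> where
      "prufer_angle {T1..T2} r Q (\<lambda>t. \<mu> * w t) (\<lambda>t. \<mu> * w t) \<theta>" "\<theta> T1 = pi/2" "\<theta> T2 = pi/2"
      by (metis diff_zero mult_zero_left of_nat_0)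
    then show "\<mu> \<in> Z" using angle_unique[of "(\<mu>, \<mu>)" \<theta> T2] T by (simp add: Z_def g_def)
  next
    assume "\<mu> \<in> Z"
    then show "principal_eigenvalue T1 T2 p q w \<mu>"
      unfolding principal_eigenvalue_iff[OF w]
      using angle_imp_C_gt[OF w w, of \<mu> \<mu> "angle (\<mu>, \<mu>)" 0] angle[of "(\<mu>, \<mu>)"]
      by (simp add: Z_def g_def)
  qed
  have above: "g a > pi/2" if "a > \<alpha>" for a
    using gt[OF that, of "angle (a, a)"] angle[of "(a, a)"] by (simp add: g_def)
  have le: "\<mu> \<le> \<alpha>" if "\<mu> \<in> Z" for \<mu>
    using above[of \<mu>] that by (cases "\<mu> \<le> \<alpha>") (auto simp: Z_def)
  \<comment> \<open>The left end for the intermediate value theorem. Equality occurs for q = 0, when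
    0 is itself a principal eigenvalue.\<close>
  have "g 0 \<le> pi/2"
    using angle_zero_weight[of "angle (0, 0)" 0] angle[of "(0, 0)"] by (simp add: g_def)
  then obtain x where "x \<in> Z"
    using IVT'[of g 0 "pi/2" "\<alpha> + 1"] above[of "\<alpha> + 1"] \<alpha> cont_g by (force simp: Z_def)
  then have ne: "Z \<noteq> {}" by auto
  have bdd: "bdd_above Z" using le by (rule bdd_aboveI)
  have "closed Z"
    unfolding Z_def by (intro closed_Collect_eq cont_g continuous_on_const)
  then have "Sup Z \<in> Z" by (rule closed_contains_Sup[OF ne bdd])
  moreover have "\<mu> \<le> Sup Z" if "\<mu> \<in> Z" for \<mu> by (rule cSup_upper[OF that bdd])
  ultimately show ?thesis using le by (auto simp: greatest_principal_def Z)
qed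

section \<open>The curve in the quadrant of nonnegative parameters\<close>

text \<open>The formulation treats m and n alike and includes the inverse, so it survives an
  exchange of the axes.\<close>

definition quadrant_curve :: "(real \<Rightarrow> real) \<Rightarrow> (real \<Rightarrow> real) \<Rightarrow> (real \<times> real) set \<Rightarrow> bool" where
  "quadrant_curve m n C \<longleftrightarrow> (\<exists>\<alpha> \<beta> f g.
    (\<exists>\<mu>\<le>\<alpha>. greatest_principal m \<mu>) \<and> (\<exists>\<mu>\<le>\<beta>. greatest_principal n \<mu>) \<and>
    C1_inverses f g {\<alpha><..} {\<beta><..} \<and> strict_antimono_on {\<alpha><..} f \<and>
    C \<inter> ({0..} \<times> {0..}) = {(a, f a) | a. a \<in> {\<alpha><..}})"

lemma quadrant_curve_swap:
  assumes "quadrant_curve m n C"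
  shows "quadrant_curve n m (prod.swap ` C)"
proof -
  obtain \<alpha> \<beta> f g where *: "\<exists>\<mu>\<le>\<alpha>. greatest_principal m \<mu>" "\<exists>\<mu>\<le>\<beta>. greatest_principal n \<mu>"
    and fg: "C1_inverses f g {\<alpha><..} {\<beta><..}" and anti: "strict_antimono_on {\<alpha><..} f"
    and C: "C \<inter> ({0..} \<times> {0..}) = {(a, f a) | a. a \<in> {\<alpha><..}}"
    using assms unfolding quadrant_curve_def by blast
  have f: "f a > \<beta>" "g (f a) = a" if "a > \<alpha>" for a
    using fg that by (auto simp: C1_inverses_def)
  have g: "g b > \<alpha>" "f (g b) = b" if "b > \<beta>" for b
    using fg that by (auto simp: C1_inverses_def)
  have "strict_antimono_on {\<beta><..} g"
  proof (rule monotone_onI, rule ccontr)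
    fix x y assume xy: "x \<in> {\<beta><..}" "y \<in> {\<beta><..}" "x < y" "\<not> g y < g x"
    have "f (g y) < f (g x)" if "g x < g y"
      by (rule monotone_onD[OF anti _ _ that]) (use g(1) xy in auto)
    then show False
      using xy g(2)[of x] g(2)[of y] by (cases "g x = g y") auto
  qed
  moreover have "prod.swap ` C \<inter> ({0..} \<times> {0..}) = {(b, g b) | b. b \<in> {\<beta><..}}"
  proof -
    have "prod.swap ` C \<inter> ({0..} \<times> {0..}) = prod.swap ` (C \<inter> ({0..} \<times> {0..}))" by auto
    also have "\<dots> = {(f a, a) | a. a \<in> {\<alpha><..}}" unfolding C by force
    also have "\<dots> = {(b, g b) | b. b \<in> {\<beta><..}}"
    proof (intro equalityI subsetI)
      fix z assume "z \<in> {(f a, a) | a. a \<in> {\<alpha><..}}"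
      then obtain a where "z = (f a, a)" "a > \<alpha>" by auto
      then show "z \<in> {(b, g b) | b. b \<in> {\<beta><..}}" using f[of a] by auto
    next
      fix z assume "z \<in> {(b, g b) | b. b \<in> {\<beta><..}}"
      then obtain b where "z = (b, g b)" "b > \<beta>" by auto
      then show "z \<in> {(f a, a) | a. a \<in> {\<alpha><..}}" using g[of b] by auto
    qed
    finally show ?thesis .
  qed
  ultimately show ?thesis
    unfolding quadrant_curve_def using * C1_inverses_sym[OF fg] by blast
qed

lemma quadrant_curve_C_gt:
  assumes m: "continuous_on {T1..T2} m" and n: "continuous_on {T1..T2} n"
    and k: "k \<ge> 1"
    and ne: "C_gt T1 T2 p q m n k \<inter> ({0..} \<times> {0..}) \<noteq> {}"
  shows "quadrant_curve m n (C_gt T1 T2 p q m n k)"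
proof -
  let ?x0 = "pi/2 - real k * pi"
  interpret prufer_family T1 T2 r Q m n ?x0
    by unfold_locales (use T cont_r cont_Q m n in auto)
  let ?v = "\<lambda>x t. fst x * m t" and ?w = "\<lambda>x t. snd x * n t"
  have c: "continuous_on {T1..T2} (\<lambda>t. c * m t)" "continuous_on {T1..T2} (\<lambda>t. c * n t)" for c
    by (intro continuous_intros m n)+
  have x0: "?x0 = pi/2 + of_int (- int k) * pi" by simp
  \<comment> \<open>As k \<ge> 1, the starting angle is at most -pi/2, so the angle runs through
    every value of ]-pi/2, pi/2[ on its way to pi/2.\<close>
  have k_pi: "1 * pi \<le> real k * pi" using k by (intro mult_right_mono) auto
  have C: "(a, b) \<in> C_gt T1 T2 p q m n k \<longleftrightarrow> angle (a, b) T2 = pi/2" for a b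
  proof
    assume "(a, b) \<in> C_gt T1 T2 p q m n k"
    from C_gt_imp_angle[OF m n this] obtain \<theta> where
      "prufer_angle {T1..T2} r Q (\<lambda>t. a * m t) (\<lambda>t. b * n t) \<theta>" "\<theta> T1 = ?x0" "\<theta> T2 = pi/2"
      by blast
    then show "angle (a, b) T2 = pi/2" using angle_unique[of "(a, b)" \<theta> T2] T by simp
  next
    assume "angle (a, b) T2 = pi/2"
    then show "(a, b) \<in> C_gt T1 T2 p q m n k"
      using angle_imp_C_gt[OF m n, of a b "angle (a, b)"] angle[of "(a, b)"] by simp
  qed
  \<comment> \<open>On the diagonal the mean slope is the derivative of the field, so
    \<open>weight\<close> is the squared amplitude times a factor independent of t.\<close>
  have R: "weight (x, x) t = (exp (integral {T1..T2} (slope (x, x)))) * (amplitude (?v x) (?w x) (angle x) t)\<^sup>2"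
    for x t
    unfolding weight_def amplitude_def power2_eq_square
    by (simp add: exp_add[symmetric] slope_def[abs_def])
  have attained: "\<exists>t\<in>{T1<..<T2}. angle x t = y"
    if "angle x T2 = pi/2" "\<bar>y\<bar> < pi/2" for x y
  proof -
    have "angle x T1 < y" using that(2) k_pi unfolding angle(1) abs_less_iff by linarith
    moreover have "y \<le> angle x T2" using that by linarith
    ultimately obtain t where "T1 \<le> t" "t \<le> T2" "angle x t = y"
      using IVT'[of "angle x" T1 y T2] T cont_angle[of x] by auto
    moreover have "t \<noteq> T1" "t \<noteq> T2" using calculation \<open>angle x T1 < y\<close> that by auto
    ultimately show ?thesis by force
  qed
  interpret level_curve "\<lambda>x. angle x T2" A B "pi/2"
  proof
    show "angle x T2 - angle y T2 = (fst x - fst y) * A (x, y) + (snd x - snd y) * B (x, y)" for x y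
      by (rule angle_diff_end)
    have "angle (0, 0) T2 \<le> ?x0"
      unfolding x0 using angle_zero_weight[of "angle (0, 0)" "- int k"] angle[of "(0, 0)"] by simp
    then show "angle (0, 0) T2 < pi/2" using k_pi pi_gt_zero by linarith
    fix x assume x: "angle x T2 = pi/2"
    then have fin: "angle x T2 = pi/2 + of_int 0 * pi" by simp
    have st: "angle x T1 = pi/2 + of_int (- int k) * pi" using angle(1)[of x] by simp
    let ?E = "exp (integral {T1..T2} (slope (x, x)))"
    let ?R = "amplitude (?v x) (?w x) (angle x)"
    show "fst x * A (x, x) > 0"
    proof -
      \<comment> \<open>At pi/4 the sine is positive and the cosine is not 0, as
        \<open>weighted_square_pos\<close> demands.\<close>
      obtain t0 where t0: "t0 \<in> {T1<..<T2}" "angle x t0 = pi/4"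
        using attained[OF x, of "pi/4"] by auto
      have "fst x * A (x, x) = integral {T1..T2} (\<lambda>t. fst x * (weight (x, x) t * (m t * pos_sin_sq (angle x t))))"
        by (simp add: A_def)
      also have "\<dots> = integral {T1..T2} (\<lambda>t. ?E * ((?R t)\<^sup>2 * (fst x * m t * pos_sin_sq (angle x t))))"
        unfolding R by (simp add: mult_ac)
      also have "\<dots> = ?E * integral {T1..T2} (\<lambda>t. (?R t)\<^sup>2 * (fst x * m t * pos_sin_sq (angle x t)))"
        by (rule integral_mult_right)
      also have "\<dots> > 0"
        by (intro mult_pos_pos weighted_square_pos[OF c(1) c(2) angle(2) st fin t0(1)])
          (simp_all add: t0 sin_45 cos_45)
      finally show ?thesis .
    qed
    show "snd x * B (x, x) > 0"
    proof -
      obtain t0 where t0: "t0 \<in> {T1<..<T2}" "angle x t0 = - (pi/4)"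
        using attained[OF x, of "- (pi/4)"] by auto
      \<comment> \<open>The shift by pi turns the negative part into the positive one, so the same
        positivity lemma applies with the weights exchanged.\<close>
      let ?\<eta> = "\<lambda>t. angle x t + pi"
      have \<eta>: "prufer_angle {T1..T2} r Q (?w x) (?v x) ?\<eta>"
        by (rule prufer_angle_add_pi[OF angle(2)])
      have periodic: "pos_sin_sq' (2 * pi + y) = pos_sin_sq' y" for y
        using sin_periodic[of y] cos_periodic[of y] by (simp only: pos_sin_sq'_def add.commute)
      have R': "amplitude (?w x) (?v x) ?\<eta> = ?R"
        by (simp add: periodic amplitude_def[abs_def] prufer_slope_def add.commute)
      have "snd x * B (x, x) = integral {T1..T2} (\<lambda>t. snd x * (weight (x, x) t * (n t * pos_sin_sq (?\<eta> t))))"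
        by (simp add: B_def)
      also have "\<dots> = integral {T1..T2} (\<lambda>t. ?E * ((?R t)\<^sup>2 * (snd x * n t * pos_sin_sq (?\<eta> t))))"
        unfolding R by (simp add: mult_ac)
      also have "\<dots> = ?E * integral {T1..T2} (\<lambda>t. (?R t)\<^sup>2 * (snd x * n t * pos_sin_sq (?\<eta> t)))"
        by (rule integral_mult_right)
      also have "\<dots> > 0"
      proof -
        have ends: "angle x T1 + pi = pi/2 + of_int (1 - int k) * pi" "angle x T2 + pi = pi/2 + of_int 1 * pi"
          unfolding st x by (simp_all add: left_diff_distrib)
        have "sin (?\<eta> t0) > 0" "cos (?\<eta> t0) \<noteq> 0"
          unfolding t0(2) sin_periodic_pi cos_periodic_pi by (simp_all add: sin_45 cos_45)
        then show ?thesis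
          unfolding R'[symmetric]
          by (intro mult_pos_pos weighted_square_pos[OF c(2) c(1) \<eta> ends t0(1)]) simp_all
      qed
      finally show ?thesis .
    qed
  qed (rule cont_A cont_B)+
  have "\<exists>x\<in>{0..} \<times> {0..}. angle x T2 = pi/2" using ne C by blast
  from level_set_quadrant[OF this] obtain \<alpha> \<beta> f g where ab: "\<alpha> \<ge> 0" "\<beta> \<ge> 0"
    and fg: "C1_inverses f g {\<alpha><..} {\<beta><..}" and anti: "strict_antimono_on {\<alpha><..} f"
    and eq: "{x\<in>{0..} \<times> {0..}. angle x T2 = pi/2} = {(a, f a) | a. a \<in> {\<alpha><..}}"
    by blast
  have on_curve: "angle (a, f a) T2 = pi/2" if "a > \<alpha>" for a
    using eq that by blast
  have "\<exists>\<mu>\<le>\<alpha>. greatest_principal m \<mu>"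
  proof (rule greatest_principal_exists[OF m ab(1)])
    fix a \<phi> assume a: "a > \<alpha>" and
      \<phi>: "prufer_angle {T1..T2} r Q (\<lambda>t. a * m t) (\<lambda>t. a * m t) \<phi>" "\<phi> T1 = pi/2"
    have "angle (a, f a) T1 < 0" using angle(1)[of "(a, f a)"] k_pi pi_gt_zero by linarith
    then show "\<phi> T2 > pi/2"
      using linear_angle_pos[OF c(1) c(2) angle(2) _ on_curve[OF a]] \<phi> by simp
  qed
  moreover have "\<exists>\<mu>\<le>\<beta>. greatest_principal n \<mu>"
  proof (rule greatest_principal_exists[OF n ab(2)])
    fix b \<psi> assume b: "b > \<beta>" and
      \<psi>: "prufer_angle {T1..T2} r Q (\<lambda>t. b * n t) (\<lambda>t. b * n t) \<psi>" "\<psi> T1 = pi/2"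
    have g: "g b > \<alpha>" "f (g b) = b" using fg b by (auto simp: C1_inverses_def)
    have fin: "angle (g b, b) T2 = pi/2" using on_curve[OF g(1)] g(2) by simp
    \<comment> \<open>The start is -pi/2 for k = 1 and at most -3 pi/2 for k \<ge> 2.\<close>
    have "angle (g b, b) T1 \<le> - pi \<or> angle (g b, b) T1 = - pi/2"
    proof (cases "k = 1")
      case False
      then have "2 * pi \<le> real k * pi" using k by (intro mult_right_mono) auto
      then show ?thesis using angle(1)[of "(g b, b)"] pi_gt_zero by linarith
    qed (use angle(1)[of "(g b, b)"] in simp)
    then show "\<psi> T2 > pi/2"
      using linear_angle_neg[OF c(1) c(2) angle(2)[of "(g b, b)"]] fin \<psi> by simp
  qed
  moreover have "C_gt T1 T2 p q m n k \<inter> ({0..} \<times> {0..}) = {(a, f a) | a. a \<in> {\<alpha><..}}"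
    unfolding eq[symmetric] using C by auto
  ultimately show ?thesis
    unfolding quadrant_curve_def using fg anti by blast
qed

end


section \<open>Reflections and the four quadrants\<close>

text \<open>Under u \<mapsto> -u the two parts of u change places, and with them a and m change
  places with b and n.\<close>

lemma C_lt_iff_C_gt: "(a, b) \<in> C_lt T1 T2 p q m n k \<longleftrightarrow> (b, a) \<in> C_gt T1 T2 p q n m k"
proof -
  have neg: "solves_P T1 T2 p q n m b a (\<lambda>t. - u t)" if sol: "solves_P T1 T2 p q m n a b u" for m n a b u
    using neumann_solution_uminus[OF sol[unfolded solves_P_def]] by (simp add: solves_P_def)
  have zeros: "nontrivial_with_zeros T1 T2 k (\<lambda>t. - u t) \<longleftrightarrow> nontrivial_with_zeros T1 T2 k u" for u
    by (simp add: nontrivial_with_zeros_def)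
  show ?thesis
  proof
    assume "(a, b) \<in> C_lt T1 T2 p q m n k"
    then obtain u where "solves_P T1 T2 p q m n a b u" "nontrivial_with_zeros T1 T2 k u" "u T2 < 0"
      by (auto simp: C_lt_def)
    then show "(b, a) \<in> C_gt T1 T2 p q n m k"
      using neg[of m n a b u] zeros[of u] by (auto simp: C_gt_def)
  next
    assume "(b, a) \<in> C_gt T1 T2 p q n m k"
    then obtain u where "solves_P T1 T2 p q n m b a u" "nontrivial_with_zeros T1 T2 k u" "u T2 > 0"
      by (auto simp: C_gt_def)
    then show "(a, b) \<in> C_lt T1 T2 p q m n k"
      using neg[of n m b a u] zeros[of u] by (auto simp: C_lt_def intro!: exI[of _ "\<lambda>t. - u t"])
  qed
qed

text \<open>Only the products a m and b n enter the equation, so a factor may be moved from a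
  parameter to its weight.\<close>

lemma reflect_weights:
  assumes "C = C_gt T1 T2 p q m n k \<or> C = C_lt T1 T2 p q m n k"
  shows "{(a, b). (\<sigma> * a, \<tau> * b) \<in> C} = C_gt T1 T2 p q (\<lambda>t. \<sigma> * m t) (\<lambda>t. \<tau> * n t) k \<or>
    {(a, b). (\<sigma> * a, \<tau> * b) \<in> C} = C_lt T1 T2 p q (\<lambda>t. \<sigma> * m t) (\<lambda>t. \<tau> * n t) k"
proof -
  have "solves_P T1 T2 p q m n (\<sigma> * a) (\<tau> * b) u =
      solves_P T1 T2 p q (\<lambda>t. \<sigma> * m t) (\<lambda>t. \<tau> * n t) a b u" for a b u
    by (simp add: solves_P_def mult_ac)
  then show ?thesis using assms by (auto simp: C_gt_def C_lt_def)
qed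

context neumann_problem
begin

text \<open>\<open>C_lt\<close> is the mirror image of a \<open>C_gt\<close> set with m and n
  exchanged. The curve is therefore obtained over the b-axis and turned back by
  \<open>quadrant_curve_swap\<close>.\<close>

lemma quadrant_curve_C:
  assumes m: "continuous_on {T1..T2} m" and n: "continuous_on {T1..T2} n" and k: "k \<ge> 1"
    and C: "C = C_gt T1 T2 p q m n k \<or> C = C_lt T1 T2 p q m n k"
    and ne: "C \<inter> ({0..} \<times> {0..}) \<noteq> {}"
  shows "quadrant_curve m n C"
  using C
proof
  assume C: "C = C_lt T1 T2 p q m n k"
  have swap: "C = prod.swap ` C_gt T1 T2 p q n m k"
    unfolding C using C_lt_iff_C_gt by (force simp: image_iff)
  have "C_gt T1 T2 p q n m k \<inter> ({0..} \<times> {0..}) \<noteq> {}" using ne unfolding swap by fastforce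
  then show ?thesis
    unfolding swap by (intro quadrant_curve_swap quadrant_curve_C_gt m n k)
qed (use quadrant_curve_C_gt[OF m n k] ne in simp)

lemma lambda_pos_eq: "greatest_principal w \<mu> \<Longrightarrow> lambda_pos T1 T2 p q w = \<mu>"
  unfolding lambda_pos_def greatest_principal_def by (blast intro: Greatest_equality)

text \<open>Negation maps the principal eigenvalues of -w onto those of w and turns a maximum into a
  minimum.\<close>

lemma lambda_neg_eq:
  assumes "greatest_principal (\<lambda>t. - 1 * w t) \<mu>"
  shows "lambda_neg T1 T2 p q w = - \<mu>"
proof -
  have "principal_eigenvalue T1 T2 p q (\<lambda>t. - 1 * w t) \<nu> \<longleftrightarrow> principal_eigenvalue T1 T2 p q w (- \<nu>)" for \<nu>
    by (simp add: principal_eigenvalue_def)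
  then show ?thesis
    using assms unfolding lambda_neg_def greatest_principal_def
    by (intro Least_equality) (auto, metis minus_le_iff minus_minus)
qed

text \<open>The values 1 and -1 of \<open>\<sigma>\<close> and \<open>\<tau>\<close> select the
  quadrant. The final equivalence is stated pointwise so that each quadrant is read off by
  substituting signs.\<close>

lemma signed_quadrant_curve:
  fixes \<sigma> \<tau> :: real
  assumes "continuous_on {T1..T2} m" "continuous_on {T1..T2} n" and "k \<ge> 1"
    and "C = C_gt T1 T2 p q m n k \<or> C = C_lt T1 T2 p q m n k"
    and "\<exists>a\<ge>0. \<exists>b\<ge>0. (\<sigma> * a, \<tau> * b) \<in> C"
  obtains \<mu> \<alpha> \<nu> \<beta> f g where "\<mu> \<le> \<alpha>" "greatest_principal (\<lambda>t. \<sigma> * m t) \<mu>"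
    "\<nu> \<le> \<beta>" "greatest_principal (\<lambda>t. \<tau> * n t) \<nu>"
    "C1_inverses f g {\<alpha><..} {\<beta><..}" "strict_antimono_on {\<alpha><..} f"
    "\<forall>a b. 0 \<le> a \<and> 0 \<le> b \<and> (\<sigma> * a, \<tau> * b) \<in> C \<longleftrightarrow> \<alpha> < a \<and> b = f a"
proof -
  have "quadrant_curve (\<lambda>t. \<sigma> * m t) (\<lambda>t. \<tau> * n t) {(a, b). (\<sigma> * a, \<tau> * b) \<in> C}"
    by (rule quadrant_curve_C[OF _ _ assms(3) reflect_weights[OF assms(4)]])
      (use assms in \<open>auto intro!: continuous_intros\<close>)
  then obtain \<alpha> \<beta> f g where *: "\<exists>\<mu>\<le>\<alpha>. greatest_principal (\<lambda>t. \<sigma> * m t) \<mu>"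
      "\<exists>\<mu>\<le>\<beta>. greatest_principal (\<lambda>t. \<tau> * n t) \<mu>"
      "C1_inverses f g {\<alpha><..} {\<beta><..}" "strict_antimono_on {\<alpha><..} f"
    and eq: "{(a, b). (\<sigma> * a, \<tau> * b) \<in> C} \<inter> ({0..} \<times> {0..}) = {(a, f a) | a. a \<in> {\<alpha><..}}"
    unfolding quadrant_curve_def by blast
  have "0 \<le> a \<and> 0 \<le> b \<and> (\<sigma> * a, \<tau> * b) \<in> C \<longleftrightarrow> \<alpha> < a \<and> b = f a" for a b
  proof -
    have "0 \<le> a \<and> 0 \<le> b \<and> (\<sigma> * a, \<tau> * b) \<in> C \<longleftrightarrow>
        (a, b) \<in> {(a, b). (\<sigma> * a, \<tau> * b) \<in> C} \<inter> ({0..} \<times> {0..})" by auto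
    also have "\<dots> \<longleftrightarrow> \<alpha> < a \<and> b = f a" unfolding eq by auto
    finally show ?thesis .
  qed
  with * that show thesis by blast
qed

end

theorem theorem1:
  fixes T1 T2 :: real and p q m n :: "real \<Rightarrow> real" and k :: nat and C :: "(real \<times> real) set"
  assumes "T1 < T2"
    and "continuous_on {T1..T2} p" and "continuous_on {T1..T2} q"
    and "continuous_on {T1..T2} m" and "continuous_on {T1..T2} n"
    and "\<And>t. t \<in> {T1..T2} \<Longrightarrow> p t > 0"
    and "\<And>t. t \<in> {T1..T2} \<Longrightarrow> q t \<ge> 0"
    and "\<exists>t\<in>{T1..T2}. m t \<noteq> 0" and "\<exists>t\<in>{T1..T2}. n t \<noteq> 0"
    and "k \<ge> 1"
    and "C = C_gt T1 T2 p q m n k \<or> C = C_lt T1 T2 p q m n k"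
  shows
    "(C \<inter> ({0..} \<times> {0..}) \<noteq> {} \<longrightarrow>
      (\<exists>\<alpha> \<beta> f. \<alpha> \<ge> lambda_pos T1 T2 p q m \<and> \<beta> \<ge> lambda_pos T1 T2 p q n \<and>
        strict_antimono_on {\<alpha><..} f \<and> C1_diffeomorphism f {\<alpha><..} {\<beta><..} \<and>
        C \<inter> ({0..} \<times> {0..}) = {(a, f a) | a. a \<in> {\<alpha><..}})) \<and>
     (C \<inter> ({..0} \<times> {0..}) \<noteq> {} \<longrightarrow>
      (\<exists>\<gamma> \<eta> g. \<gamma> \<le> lambda_neg T1 T2 p q m \<and> \<eta> \<ge> lambda_pos T1 T2 p q n \<and>
        strict_mono_on {..<\<gamma>} g \<and> C1_diffeomorphism g {..<\<gamma>} {\<eta><..} \<and>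
        C \<inter> ({..0} \<times> {0..}) = {(a, g a) | a. a \<in> {..<\<gamma>}})) \<and>
     (C \<inter> ({0..} \<times> {..0}) \<noteq> {} \<longrightarrow>
      (\<exists>\<gamma> \<eta> g. \<gamma> \<ge> lambda_pos T1 T2 p q m \<and> \<eta> \<le> lambda_neg T1 T2 p q n \<and>
        strict_mono_on {\<gamma><..} g \<and> C1_diffeomorphism g {\<gamma><..} {..<\<eta>} \<and>
        C \<inter> ({0..} \<times> {..0}) = {(a, g a) | a. a \<in> {\<gamma><..}})) \<and>
     (C \<inter> ({..0} \<times> {..0}) \<noteq> {} \<longrightarrow>
      (\<exists>\<gamma> \<eta> g. \<gamma> \<le> lambda_neg T1 T2 p q m \<and> \<eta> \<le> lambda_neg T1 T2 p q n \<and>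
        strict_antimono_on {..<\<gamma>} g \<and> C1_diffeomorphism g {..<\<gamma>} {..<\<eta>} \<and>
        C \<inter> ({..0} \<times> {..0}) = {(a, g a) | a. a \<in> {..<\<gamma>}}))"
proof (intro conjI impI)
  interpret neumann_problem T1 T2 p q by unfold_locales fact+
  note curve = signed_quadrant_curve[OF assms(4,5,10,11)]
  {
    assume "C \<inter> ({0..} \<times> {0..}) \<noteq> {}"
    then have "\<exists>a\<ge>0. \<exists>b\<ge>0. (1 * a, 1 * b) \<in> C" by auto
    then obtain \<mu> \<alpha> \<nu> \<beta> f g where
      le: "\<mu> \<le> \<alpha>" "greatest_principal (\<lambda>t. 1 * m t) \<mu>" "\<nu> \<le> \<beta>" "greatest_principal (\<lambda>t. 1 * n t) \<nu>"
      and fg: "C1_inverses f g {\<alpha><..} {\<beta><..}" and anti: "strict_antimono_on {\<alpha><..} f"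
      and mem: "\<forall>a b. 0 \<le> a \<and> 0 \<le> b \<and> (1 * a, 1 * b) \<in> C \<longleftrightarrow> \<alpha> < a \<and> b = f a"
      by (rule curve)
    note mem = mem[rule_format]
    show "\<exists>\<alpha> \<beta> f. \<alpha> \<ge> lambda_pos T1 T2 p q m \<and> \<beta> \<ge> lambda_pos T1 T2 p q n \<and>
        strict_antimono_on {\<alpha><..} f \<and> C1_diffeomorphism f {\<alpha><..} {\<beta><..} \<and>
        C \<inter> ({0..} \<times> {0..}) = {(a, f a) | a. a \<in> {\<alpha><..}}"
    proof (intro exI conjI)
      show "lambda_pos T1 T2 p q m \<le> \<alpha>" "lambda_pos T1 T2 p q n \<le> \<beta>"
        using le lambda_pos_eq[of m] lambda_pos_eq[of n] by simp_all
      show "strict_antimono_on {\<alpha><..} f" by fact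
      show "C1_diffeomorphism f {\<alpha><..} {\<beta><..}"
        by (rule C1_inverses_imp_diffeomorphism[OF fg]) simp
      show "C \<inter> ({0..} \<times> {0..}) = {(a, f a) | a. a \<in> {\<alpha><..}}"
        using mem by auto
    qed
  }
  {
    assume "C \<inter> ({..0} \<times> {0..}) \<noteq> {}"
    then obtain a b where "(a, b) \<in> C" "a \<le> 0" "b \<ge> 0" by auto
    \<comment> \<open>Reflecting a gives the left end of the range of a as a right end -\<alpha>,
      and the increasing function a \<mapsto> f (-a).\<close>
    then have "\<exists>a\<ge>0. \<exists>b\<ge>0. (- 1 * a, 1 * b) \<in> C" by (intro exI[of _ "- a"] exI[of _ b] conjI) simp_all
    then obtain \<mu> \<alpha> \<nu> \<beta> f g where
      le: "\<mu> \<le> \<alpha>" "greatest_principal (\<lambda>t. - 1 * m t) \<mu>" "\<nu> \<le> \<beta>" "greatest_principal (\<lambda>t. 1 * n t) \<nu>"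
      and fg: "C1_inverses f g {\<alpha><..} {\<beta><..}" and anti: "strict_antimono_on {\<alpha><..} f"
      and mem: "\<forall>a b. 0 \<le> a \<and> 0 \<le> b \<and> (- 1 * a, 1 * b) \<in> C \<longleftrightarrow> \<alpha> < a \<and> b = f a"
      by (rule curve)
    note mem = mem[rule_format]
    show "\<exists>\<gamma> \<eta> g. \<gamma> \<le> lambda_neg T1 T2 p q m \<and> \<eta> \<ge> lambda_pos T1 T2 p q n \<and>
        strict_mono_on {..<\<gamma>} g \<and> C1_diffeomorphism g {..<\<gamma>} {\<eta><..} \<and>
        C \<inter> ({..0} \<times> {0..}) = {(a, g a) | a. a \<in> {..<\<gamma>}}"
    proof (intro exI conjI)
      show "- \<alpha> \<le> lambda_neg T1 T2 p q m" "lambda_pos T1 T2 p q n \<le> \<beta>"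
        using le lambda_neg_eq[OF le(2)] lambda_pos_eq[of n] by simp_all
      show "strict_mono_on {..<- \<alpha>} (\<lambda>a. f (- a))"
        using anti by (auto simp: monotone_on_def)
      show "C1_diffeomorphism (\<lambda>a. f (- a)) {..<- \<alpha>} {\<beta><..}"
        using C1_inverses_reflect_domain[OF fg]
        by (auto intro!: C1_inverses_imp_diffeomorphism)
      show "C \<inter> ({..0} \<times> {0..}) = {(a, f (- a)) | a. a \<in> {..<- \<alpha>}}"
        using mem[of "- _"] by (auto simp: less_minus_iff)
    qed
  }
  {
    assume "C \<inter> ({0..} \<times> {..0}) \<noteq> {}"
    then obtain a b where "(a, b) \<in> C" "a \<ge> 0" "b \<le> 0" by auto
    \<comment> \<open>Reflecting b gives the increasing function -f, whose range ends at
      -\<beta>.\<close>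
    then have "\<exists>a\<ge>0. \<exists>b\<ge>0. (1 * a, - 1 * b) \<in> C" by (intro exI[of _ a] exI[of _ "- b"] conjI) simp_all
    then obtain \<mu> \<alpha> \<nu> \<beta> f g where
      le: "\<mu> \<le> \<alpha>" "greatest_principal (\<lambda>t. 1 * m t) \<mu>" "\<nu> \<le> \<beta>" "greatest_principal (\<lambda>t. - 1 * n t) \<nu>"
      and fg: "C1_inverses f g {\<alpha><..} {\<beta><..}" and anti: "strict_antimono_on {\<alpha><..} f"
      and mem: "\<forall>a b. 0 \<le> a \<and> 0 \<le> b \<and> (1 * a, - 1 * b) \<in> C \<longleftrightarrow> \<alpha> < a \<and> b = f a"
      by (rule curve)
    note mem = mem[rule_format]
    show "\<exists>\<gamma> \<eta> g. \<gamma> \<ge> lambda_pos T1 T2 p q m \<and> \<eta> \<le> lambda_neg T1 T2 p q n \<and>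
        strict_mono_on {\<gamma><..} g \<and> C1_diffeomorphism g {\<gamma><..} {..<\<eta>} \<and>
        C \<inter> ({0..} \<times> {..0}) = {(a, g a) | a. a \<in> {\<gamma><..}}"
    proof (intro exI conjI)
      show "lambda_pos T1 T2 p q m \<le> \<alpha>" "- \<beta> \<le> lambda_neg T1 T2 p q n"
        using le lambda_neg_eq[OF le(4)] lambda_pos_eq[of m] by simp_all
      show "strict_mono_on {\<alpha><..} (\<lambda>a. - f a)"
        using anti by (auto simp: monotone_on_def)
      show "C1_diffeomorphism (\<lambda>a. - f a) {\<alpha><..} {..<- \<beta>}"
        using C1_inverses_reflect_range[OF fg]
        by (auto intro!: C1_inverses_imp_diffeomorphism)
      have "(a, b) \<in> C \<inter> ({0..} \<times> {..0}) \<longleftrightarrow> \<alpha> < a \<and> b = - f a" for a b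
        using mem[of a "- b"] by auto
      then show "C \<inter> ({0..} \<times> {..0}) = {(a, - f a) | a. a \<in> {\<alpha><..}}"
        by auto
    qed
  }
  {
    assume "C \<inter> ({..0} \<times> {..0}) \<noteq> {}"
    then obtain a b where "(a, b) \<in> C" "a \<le> 0" "b \<le> 0" by auto
    \<comment> \<open>Two reflections restore the decrease: the function is a \<mapsto> -f
      (-a).\<close>
    then have "\<exists>a\<ge>0. \<exists>b\<ge>0. (- 1 * a, - 1 * b) \<in> C" by (intro exI[of _ "- a"] exI[of _ "- b"] conjI) simp_all
    then obtain \<mu> \<alpha> \<nu> \<beta> f g where
      le: "\<mu> \<le> \<alpha>" "greatest_principal (\<lambda>t. - 1 * m t) \<mu>" "\<nu> \<le> \<beta>" "greatest_principal (\<lambda>t. - 1 * n t) \<nu>"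
      and fg: "C1_inverses f g {\<alpha><..} {\<beta><..}" and anti: "strict_antimono_on {\<alpha><..} f"
      and mem: "\<forall>a b. 0 \<le> a \<and> 0 \<le> b \<and> (- 1 * a, - 1 * b) \<in> C \<longleftrightarrow> \<alpha> < a \<and> b = f a"
      by (rule curve)
    note mem = mem[rule_format]
    show "\<exists>\<gamma> \<eta> g. \<gamma> \<le> lambda_neg T1 T2 p q m \<and> \<eta> \<le> lambda_neg T1 T2 p q n \<and>
        strict_antimono_on {..<\<gamma>} g \<and> C1_diffeomorphism g {..<\<gamma>} {..<\<eta>} \<and>
        C \<inter> ({..0} \<times> {..0}) = {(a, g a) | a. a \<in> {..<\<gamma>}}"
    proof (intro exI conjI)
      show "- \<alpha> \<le> lambda_neg T1 T2 p q m" "- \<beta> \<le> lambda_neg T1 T2 p q n"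
        using le lambda_neg_eq[OF le(2)] lambda_neg_eq[OF le(4)] by simp_all
      show "strict_antimono_on {..<- \<alpha>} (\<lambda>a. - f (- a))"
        using anti by (auto simp: monotone_on_def)
      show "C1_diffeomorphism (\<lambda>a. - f (- a)) {..<- \<alpha>} {..<- \<beta>}"
        using C1_inverses_reflect_domain[OF C1_inverses_reflect_range[OF fg]]
        by (auto intro!: C1_inverses_imp_diffeomorphism)
      have "(a, b) \<in> C \<inter> ({..0} \<times> {..0}) \<longleftrightarrow> a < - \<alpha> \<and> b = - f (- a)" for a b
        using mem[of "- a" "- b"] by auto
      then show "C \<inter> ({..0} \<times> {..0}) = {(a, - f (- a)) | a. a \<in> {..<- \<alpha>}}"
        by auto
    qed
  }
qed

end
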